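(* For every integer $r\geq 4$, let $k=\lceil r/e\rceil$. Then $\pi(\mathcal{F}_{r,k})=r!/r^r$.
   Context: For a family $\mathcal{F}$ of $r$-uniform hypergraphs, an $r$-uniform hypergraph is $\mathcal{F}$-free if it contains no member of $\mathcal{F}$ as a subgraph; $\mathrm{ex}(n,\mathcal{F})$ is the maximum number of edges in an $\mathcal{F}$-free $r$-uniform hypergraph on $n$ vertices, and the Turán density is $\pi(\mathcal{F})=\lim_{n\to\infty}\mathrm{ex}(n,\mathcal{F})/\binom{n}{r}$. For $1\leq i\leq\lfloor r/2\rfloor$, the $(r-i,i)$-tent $\Delta_{(r-i,i)}$ is the $r$-uniform hypergraph with vertex set $\{1,\dots,2r-1\}$ and the three edges $\{1,2,\ldots,r\}$, $\{1,\ldots,i,r+1,\ldots,2r-i-1,2r-1\}$, $\{i+1,\ldots,r,2r-i,\ldots,2r-1\}$. For $1\leq k\leq\lfloor r/2\rfloor$, $\mathcal{F}_{r,k}=\{\Delta_{(r-i,i)}: 1\leq i\leq k\}$. *)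

theory Defs
  imports Complex_Main
begin

type_synonym 'a hypergraph = "'a set \<times> 'a set set"

abbreviation verts :: "'a hypergraph \<Rightarrow> 'a set" where
  "verts H \<equiv> fst H"

abbreviation edges :: "'a hypergraph \<Rightarrow> 'a set set" where
  "edges H \<equiv> snd H"

definition uniform_hypergraph :: "nat \<Rightarrow> 'a hypergraph \<Rightarrow> bool" where
  "uniform_hypergraph r H \<longleftrightarrow>
     finite (verts H) \<and> (\<forall>e\<in>edges H. e \<subseteq> verts H \<and> card e = r)"

text \<open>Containment is up to isomorphism, and subgraphs need not be induced.\<close>

definition contains_subgraph :: "'a hypergraph \<Rightarrow> 'b hypergraph \<Rightarrow> bool" where
  "contains_subgraph H F \<longleftrightarrow>
     (\<exists>f. inj_on f (verts F) \<and> f ` verts F \<subseteq> verts H \<and> (\<forall>e\<in>edges F. f ` e \<in> edges H))"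

definition family_free :: "'b hypergraph set \<Rightarrow> 'a hypergraph \<Rightarrow> bool" where
  "family_free \<F> H \<longleftrightarrow> (\<forall>F\<in>\<F>. \<not> contains_subgraph H F)"

text \<open>
  Since \<^typ>\<open>nat\<close> is infinite, it is no restriction to take host hypergraphs with vertices
  in \<^typ>\<open>nat\<close>. The set of edge counts is bounded by \<open>n choose r\<close>; it is nonempty as soon as
  no member of the family is edgeless.
\<close>

definition turan_number :: "nat \<Rightarrow> 'b hypergraph set \<Rightarrow> nat \<Rightarrow> nat" where
  "turan_number r \<F> n =
     Max {card (edges H) | H :: nat hypergraph.
            uniform_hypergraph r H \<and> card (verts H) = n \<and> family_free \<F> H}"

definition turan_ratio :: "nat \<Rightarrow> 'b hypergraph set \<Rightarrow> nat \<Rightarrow> real" where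
  "turan_ratio r \<F> n = real (turan_number r \<F> n) / real (n choose r)"

definition turan_density :: "nat \<Rightarrow> 'b hypergraph set \<Rightarrow> real" where
  "turan_density r \<F> = lim (turan_ratio r \<F>)"

text \<open>\<open>tent r i\<close> is the \<open>(r - i, i)\<close>-tent; it is meant for \<open>1 \<le> i \<le> r div 2\<close>.\<close>

definition tent :: "nat \<Rightarrow> nat \<Rightarrow> nat hypergraph" where
  "tent r i =
     ({1..2 * r - 1},
      {{1..r},
       {1..i} \<union> {r + 1..2 * r - i - 1} \<union> {2 * r - 1},
       {i + 1..r} \<union> {2 * r - i..2 * r - 1}})"

definition tent_family :: "nat \<Rightarrow> nat \<Rightarrow> nat hypergraph set" where
  "tent_family r k = {tent r i | i. 1 \<le> i \<and> i \<le> k}"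

end

(*
  Lower bound: in a complete r-partite hypergraph the vertex shared by the second and third edge of
  a tent has the colour of a vertex of the first edge, which lies in one of these two edges.

  Upper bound, by an entropy argument of Chao and Yu. Deleting O(n^(r-1)) edges makes every
  non-empty set that is still covered by an edge have large codegree. If a vertex v then extended
  both parts of an edge split as A and B with |B| = i <= k, the edges through A + v and B + v could
  be chosen otherwise disjoint and would form a tent. So no such v exists. For a uniformly random
  ordered edge X_1, ..., X_r put x_m = exp (H (X_(r-m+1) | X_1, ..., X_(r-m)) - H (X_1)).
  Disjointness of the supports of the next vertex given C + A and given C + B turns into
  x_i + x_j <= x_(i+j) for i <= k. Such a sequence satisfies sum x_i / i <= x_r = 1, provided that
  1/(k+1) + ... + 1/r <= 1, which holds as k >= r/e. By exp (t - 1) >= t, the product of the x_i is at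
  most r!/r^r, and the chain rule bounds the number of ordered edges by n^r times this product.
*)
theory Submission
  imports Defs "HOL-Library.FuncSet" "HOL-Combinatorics.Permutations"
begin

section \<open>Inequalities for real sequences, ending in the product bound r!/r^r\<close>

section \<open>Restricted superadditive sequences\<close>

text \<open>Summation by parts: the right side minus the left is the sum over m < n of -(c (m+1) - c
  m) * (u 1 + ... + u m), and no term of it is negative. The weights may have any sign.\<close>

lemma abel_partial_sums_le:
  fixes c u :: "nat \<Rightarrow> real"
  assumes "\<And>m. \<lbrakk>1 \<le> m; m < n\<rbrakk> \<Longrightarrow> c m \<le> c (Suc m)"
    and "\<And>m. \<lbrakk>1 \<le> m; m < n\<rbrakk> \<Longrightarrow> (\<Sum>i=1..m. u i) \<le> 0"
    and "1 \<le> n"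
  shows "c n * (\<Sum>i=1..n. u i) \<le> (\<Sum>i=1..n. c i * u i)"
  using assms
proof (induction n)
  case (Suc n)
  show ?case
  proof (cases "n = 0")
    case False
    have "c n * (\<Sum>i=1..n. u i) \<le> (\<Sum>i=1..n. c i * u i)"
      using False Suc.prems by (intro Suc.IH) auto
    moreover have "c (Suc n) * (\<Sum>i=1..n. u i) \<le> c n * (\<Sum>i=1..n. u i)"
      using False Suc.prems by (intro mult_right_mono_neg) auto
    ultimately show ?thesis
      by (simp add: algebra_simps)
  qed simp
qed simp

text \<open>Chebyshev's sum inequality, with monotonicity of \<open>t\<close> weakened to a
  condition on initial averages. Subtracting the mean makes the partial sums nonpositive and the
  last one zero, so summation by parts applies.\<close>

lemma chebyshev_partial_averages:
  fixes c t :: "nat \<Rightarrow> real"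
  assumes c: "\<And>m. \<lbrakk>1 \<le> m; m < k\<rbrakk> \<Longrightarrow> c m \<le> c (Suc m)"
    and avg: "\<And>m. \<lbrakk>1 \<le> m; m < k\<rbrakk> \<Longrightarrow> real k * (\<Sum>i=1..m. t i) \<le> real m * (\<Sum>i=1..k. t i)"
    and k: "1 \<le> k"
  shows "(\<Sum>i=1..k. t i) / real k * (\<Sum>i=1..k. c i) \<le> (\<Sum>i=1..k. c i * t i)"
proof -
  define S where "S = (\<Sum>i=1..k. t i)"
  define u where "u = (\<lambda>i. t i - S / k)"
  have su: "(\<Sum>i=1..m. u i) = (\<Sum>i=1..m. t i) - m * S / k" for m
    by (simp add: u_def sum_subtractf)
  have "c k * (\<Sum>i=1..k. u i) \<le> (\<Sum>i=1..k. c i * u i)"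
  proof (rule abel_partial_sums_le)
    fix m assume m: "1 \<le> m" "m < k"
    have "k * (\<Sum>i=1..m. u i) \<le> 0"
      using avg[OF m] k unfolding su S_def by (simp add: right_diff_distrib)
    then show "(\<Sum>i=1..m. u i) \<le> 0"
      using k by (simp add: mult_le_0_iff)
  qed (use c k in auto)
  moreover have "(\<Sum>i=1..k. u i) = 0"
    using k unfolding su S_def by simp
  moreover have "(\<Sum>i=1..k. c i * u i) = (\<Sum>i=1..k. c i * t i) - S / k * (\<Sum>i=1..k. c i)"
    by (simp add: u_def right_diff_distrib sum_subtractf sum_distrib_left mult.commute)
  ultimately show ?thesis by (simp add: S_def)
qed

lemma sum_partial_sums:
  fixes t :: "nat \<Rightarrow> real"
  shows "(\<Sum>m=1..n. \<Sum>i=1..m. t i) = (real n + 1) * (\<Sum>i=1..n. t i) - (\<Sum>i=1..n. real i * t i)"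
  by (induction n) (auto simp: algebra_simps)

text \<open>Strong induction: with T m for the left side, adding T p <= x p over p < m gives m * T
  (m-1) <= 2 * (x 1 + ... + x (m-1)). Pairing x p with x (m-p) bounds this by (m-1) * x m, which
  leaves exactly the room for the last term x m / m.\<close>

lemma superadditive_sum_le:
  fixes x :: "nat \<Rightarrow> real"
  assumes sup: "\<And>i j. \<lbrakk>1 \<le> i; 1 \<le> j; i + j \<le> n\<rbrakk> \<Longrightarrow> x i + x j \<le> x (i + j)"
    and "1 \<le> m" "m \<le> n"
  shows "(\<Sum>i=1..m. x i / real i) \<le> x m"
  using assms(2,3)
proof (induction m rule: less_induct)
  case (less m)
  then obtain q where q: "m = Suc q" by (cases m) auto
  define T where "T = (\<Sum>i=1..q. x i / real i)"
  have *: "(\<Sum>p=1..q. \<Sum>i=1..p. x i / real i) \<le> (\<Sum>p=1..q. x p)"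
    using less q by (intro sum_mono) auto
  have 1: "(real q + 1) * T \<le> 2 * (\<Sum>p=1..q. x p)"
  proof -
    have "(\<Sum>i=1..q. real i * (x i / real i)) = (\<Sum>p=1..q. x p)"
      by (intro sum.cong) auto
    then show ?thesis
      using * unfolding sum_partial_sums T_def by linarith
  qed
  have "(\<Sum>p=1..q. x p) = (\<Sum>p=1..q. x (m - p))"
    by (rule sum.reindex_bij_witness[of _ "\<lambda>p. m - p" "\<lambda>p. m - p"]) (auto simp: q)
  then have "2 * (\<Sum>p=1..q. x p) = (\<Sum>p=1..q. x p + x (m - p))"
    by (simp add: sum.distrib)
  also have "\<dots> \<le> (\<Sum>p=1..q. x m)"
  proof (rule sum_mono)
    fix p assume "p \<in> {1..q}"
    then show "x p + x (m - p) \<le> x m"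
      using sup[of p "m - p"] less.prems q by auto
  qed
  finally have "(real q + 1) * T \<le> real q * x m"
    using 1 by simp
  then have "T \<le> real q * x m / (real q + 1)"
    by (simp add: field_simps)
  also have "\<dots> = x m - x m / real m"
    by (simp add: q field_simps)
  finally show ?case
    by (simp add: T_def q)
qed

text \<open>Pairs with both indices above k are not controlled, so the terms with i > k are read
  from the top as x r - N (r - i). Bounding N below by x up to k and by a linear function beyond
  reduces the claim to Chebyshev's inequality for the first k terms. The harmonic condition enters
  as a nonnegative slack.\<close>

lemma restricted_superadditive_sum_le:
  fixes x :: "nat \<Rightarrow> real"
  assumes sup: "\<And>i j. \<lbrakk>1 \<le> i; i \<le> k; 1 \<le> j; i + j \<le> r\<rbrakk> \<Longrightarrow> x i + x j \<le> x (i + j)"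
    and k: "1 \<le> k" "k < r"
    and harm: "(\<Sum>j=k+1..r. 1 / real j) \<le> 1"
  shows "(\<Sum>i=1..r. x i / real i) \<le> x r"
proof (cases "r \<le> 2 * k + 1")
  \<comment> \<open>Here i + j <= r forces i <= k or j <= k, so superadditivity holds for all
    pairs.\<close>
  case True
  show ?thesis
  proof (rule superadditive_sum_le[where n = r])
    fix i j :: nat assume *: "1 \<le> i" "1 \<le> j" "i + j \<le> r"
    then consider "i \<le> k" | "j \<le> k" using True by linarith
    then show "x i + x j \<le> x (i + j)"
      by cases (use * sup[of i j] sup[of j i] in \<open>auto simp: add.commute\<close>)
  qed (use k in auto)
next
  case False
  then have r: "2 * k + 1 < r" by simp
  define T where "T = (\<lambda>m. \<Sum>i=1..m. x i / real i)"
  have T_le: "T m \<le> x m" if "1 \<le> m" "m \<le> k" for m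
    unfolding T_def using that r by (intro superadditive_sum_le[where n = k] sup) auto
  \<comment> \<open>From T (m+1) <= x (m+1), the new term x (m+1) / (m+1) is at least T m / m. Hence
    the averages T m / m are nondecreasing up to k.\<close>
  have T_step: "real (Suc m) * T m \<le> real m * T (Suc m)" if "1 \<le> m" "Suc m \<le> k" for m
  proof -
    have T_Suc: "T (Suc m) = T m + x (Suc m) / real (Suc m)" by (simp add: T_def)
    have "real (Suc m) * T (Suc m) \<le> real (Suc m) * x (Suc m)"
      using T_le[of "Suc m"] that by (intro mult_left_mono) auto
    then have "real (Suc m) * T m \<le> real m * x (Suc m)"
      unfolding T_Suc distrib_left by (simp add: algebra_simps del: of_nat_Suc) (simp add: algebra_simps)
    then have "T m \<le> real m * x (Suc m) / real (Suc m)"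
      by (simp add: field_simps)
    then show ?thesis
      unfolding T_Suc by (simp add: field_simps)
  qed
  have T_avg: "real k * T m \<le> real m * T k" if "1 \<le> m" "m \<le> k" for m
  proof -
    have "T m / real m \<le> T k / real k"
      using that(2,1)
    proof (induction k rule: dec_induct)
      case (step l)
      have "T l / real l \<le> T (Suc l) / real (Suc l)"
        using T_step[of l] step by (simp add: field_simps)
      then show ?case using step by linarith
    qed simp
    then show ?thesis using that by (simp add: field_simps)
  qed
  \<comment> \<open>The mean of x i / i over i <= k, used as the slope of the linear comparison
    sequence.\<close>
  define a where "a = T k / real k"
  have cheb: "a * (\<Sum>i=1..k. c i) \<le> (\<Sum>i=1..k. c i * (x i / real i))"
    if "\<And>m. \<lbrakk>1 \<le> m; m < k\<rbrakk> \<Longrightarrow> c m \<le> c (Suc m)" for c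
    unfolding a_def T_def
    using that T_avg k by (intro chebyshev_partial_averages) (auto simp: T_def)
  \<comment> \<open>Chebyshev with the nondecreasing weights that are i on l..k and 0 below
    l.\<close>
  have tail: "a * (\<Sum>i=l..k. real i) \<le> (\<Sum>i=l..k. x i)" if "1 \<le> l" for l
  proof -
    define c where "c = (\<lambda>i. if l \<le> i then real i else 0)"
    have "(\<Sum>i=1..k. c i) = (\<Sum>i=l..k. real i)"
      using that by (intro sum.mono_neutral_cong_right) (auto simp: c_def)
    moreover have "(\<Sum>i=1..k. c i * (x i / real i)) = (\<Sum>i=l..k. x i)"
      using that by (intro sum.mono_neutral_cong_right) (auto simp: c_def)
    moreover have "c m \<le> c (Suc m)" for m by (auto simp: c_def)
    ultimately show ?thesis using cheb[of c] by simp
  qed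
  \<comment> \<open>Growth of x over the last s places. The separate value at s = r stands for the
    convention x 0 = 0, since nothing is assumed about x 0.\<close>
  define N where "N = (\<lambda>s. if s = r then x r else x r - x (r - s))"
  have N_small: "x s \<le> N s" if "1 \<le> s" "s \<le> k" for s
  proof -
    have "x s + x (r - s) \<le> x (s + (r - s))"
      using sup[of s "r - s"] that r by force
    then show ?thesis using that r by (simp add: N_def)
  qed
  have N_step: "N s + x i \<le> N (s + i)" if "1 \<le> i" "i \<le> k" "s + i \<le> r" "1 \<le> s" for s i
  proof (cases "s + i = r")
    case True
    then have "x (r - s) = x i" "s \<noteq> r" using that by auto
    then show ?thesis using True by (simp add: N_def)
  next
    case False
    then show ?thesis
      using sup[of i "r - s - i"] that
      by (cases "1 \<le> r - s - i") (auto simp: N_def)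
  qed
  \<comment> \<open>Induction by averaging N s >= N (s - i) + x i over i = 1..k: in total the linear
    bounds a * (s - i) and a * i add up to k * a * s.\<close>
  have N_large: "a * real s \<le> N s" if "k \<le> s" "s \<le> r" for s
    using that
  proof (induction s rule: less_induct)
    case (less s)
    show ?case
    proof (cases "s = k")
      case True
      have "a * real k \<le> x k" using k T_le[of k] by (simp add: a_def)
      then show ?thesis using N_small[of k] k True by simp
    next
      case False
      then have s: "k < s" using less.prems by simp
      have "a * (\<Sum>p=s-k..s-1. real p) \<le> (\<Sum>p=s-k..s-1. N p)"
      proof (cases "s - k \<le> k")
        case True
        have split: "(\<Sum>p=s-k..s-1. f p) = (\<Sum>p=s-k..k. f p) + (\<Sum>p=k+1..s-1. f p)"
          for f :: "nat \<Rightarrow> real"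
          using True s sum.ub_add_nat[of "s-k" k f "s-1-k"] by simp
        have "a * (\<Sum>p=s-k..k. real p) \<le> (\<Sum>p=s-k..k. x p)"
          using s by (intro tail) auto
        also have "\<dots> \<le> (\<Sum>p=s-k..k. N p)"
          using s by (intro sum_mono N_small) auto
        finally have 1: "a * (\<Sum>p=s-k..k. real p) \<le> (\<Sum>p=s-k..k. N p)" .
        have "(\<Sum>p=k+1..s-1. a * real p) \<le> (\<Sum>p=k+1..s-1. N p)"
          using less.prems by (intro sum_mono less.IH) auto
        then show ?thesis unfolding split[of real] split[of N] using 1
          by (simp add: distrib_left sum_distrib_left)
      next
        case False
        have "(\<Sum>p=s-k..s-1. a * real p) \<le> (\<Sum>p=s-k..s-1. N p)"
          using less.prems False s by (intro sum_mono less.IH) auto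
        then show ?thesis by (simp add: sum_distrib_left)
      qed
      moreover have "(\<Sum>p=s-k..s-1. f p) = (\<Sum>i=1..k. f (s - i))" for f :: "nat \<Rightarrow> real"
        using s by (intro sum.reindex_bij_witness[of _ "\<lambda>p. s - p" "\<lambda>p. s - p"]) auto
      moreover have "a * (\<Sum>i=1..k. real i) \<le> (\<Sum>i=1..k. x i)"
        by (rule tail) simp
      ultimately have "a * (\<Sum>i=1..k. real (s - i) + real i) \<le> (\<Sum>i=1..k. N (s - i) + x i)"
        by (simp add: sum.distrib distrib_left)
      moreover have "(\<Sum>i=1..k. real (s - i) + real i) = (\<Sum>i=1..k. real s)"
        using s by (intro sum.cong) auto
      moreover have "(\<Sum>i=1..k. N (s - i) + x i) \<le> (\<Sum>i=1..k. N s)"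
      proof (rule sum_mono)
        fix i assume "i \<in> {1..k}"
        then show "N (s - i) + x i \<le> N s"
          using N_step[of i "s - i"] s less.prems by auto
      qed
      ultimately have "real k * (a * real s) \<le> real k * N s" by (simp add: mult_ac)
      then show ?thesis using k by simp
    qed
  qed
  define \<delta> where "\<delta> = 1 - (\<Sum>j=k+1..r. 1 / real j)"
  have \<delta>: "0 \<le> \<delta>" using harm by (simp add: \<delta>_def)
  \<comment> \<open>For s <= k, the bound N s >= x s turns x s / s - N s / (r - s) into at most w s
    * (x s / s). These weights decrease, so Chebyshev applies to their negatives.\<close>
  define w where "w = (\<lambda>s. 1 - real s / real (r - s))"
  have flip: "(\<Sum>j=k+1..r-1. f j) = (\<Sum>s=1..r-k-1. f (r - s))" for f :: "nat \<Rightarrow> real"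
    using r by (intro sum.reindex_bij_witness[of _ "\<lambda>p. r - p" "\<lambda>p. r - p"]) auto
  have split3: "(\<Sum>i=1..r. f i) = (\<Sum>i=1..k. f i) + (\<Sum>s=1..r-k-1. f (r - s)) + f r"
    for f :: "nat \<Rightarrow> real"
  proof -
    have "(\<Sum>i=1..r. f i) = (\<Sum>i=1..k. f i) + (\<Sum>j=k+1..r. f j)"
      using sum.ub_add_nat[of 1 k f "r-k"] k by simp
    moreover have "(\<Sum>j=k+1..r. f j) = (\<Sum>j=k+1..r-1. f j) + f r"
      using k sum.nat_ivl_Suc'[of "k+1" "r-1" f] by simp
    ultimately show ?thesis unfolding flip[symmetric] by simp
  qed
  have harm': "(\<Sum>s=1..r-k-1. 1 / real (r - s)) + 1 / real r = 1 - \<delta>"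
  proof -
    have "(\<Sum>j=k+1..r. 1 / real j) = (\<Sum>j=k+1..r-1. 1 / real j) + 1 / real r"
      using k sum.nat_ivl_Suc'[of "k+1" "r-1" "\<lambda>j. 1 / real j"] by simp
    then show ?thesis using flip[of "\<lambda>j. 1 / real j"] unfolding \<delta>_def by linarith
  qed
  have split2: "(\<Sum>s=1..r-k-1. f s) = (\<Sum>s=1..k. f s) + (\<Sum>s=k+1..r-k-1. f s)"
    for f :: "nat \<Rightarrow> real"
    using r sum.ub_add_nat[of 1 k f "r-k-1-k"] by simp
  have Nx: "x (r - s) = x r - N s" if "s \<in> {1..r-k-1}" for s
    using that k by (auto simp: N_def)
  have "(\<Sum>i=1..r. x i / real i)
      = (\<Sum>i=1..k. x i / real i) + (\<Sum>s=1..r-k-1. x r * (1 / real (r - s)) - N s / real (r - s)) + x r / real r"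
  proof -
    have "(\<Sum>s=1..r-k-1. x (r - s) / real (r - s))
        = (\<Sum>s=1..r-k-1. x r * (1 / real (r - s)) - N s / real (r - s))"
      by (rule sum.cong[OF refl]) (simp only: Nx, simp add: diff_divide_distrib)
    then show ?thesis unfolding split3 by simp
  qed
  also have "\<dots> = (\<Sum>i=1..k. x i / real i) + x r * (1 - \<delta>) - (\<Sum>s=1..r-k-1. N s / real (r - s))"
    unfolding harm'[symmetric] by (simp add: sum_subtractf sum_distrib_left distrib_left)
  finally have main: "(\<Sum>i=1..r. x i / real i) =
      (\<Sum>i=1..k. x i / real i) + x r * (1 - \<delta>) - (\<Sum>s=1..r-k-1. N s / real (r - s))" .
  have "(\<Sum>s=1..k. x s / real (r - s)) + (\<Sum>s=k+1..r-k-1. a * real s / real (r - s))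
     \<le> (\<Sum>s=1..r-k-1. N s / real (r - s))"
    unfolding split2 using N_small N_large r
    by (intro add_mono sum_mono divide_right_mono) auto
  \<comment> \<open>The slack is paid for by x r = N r >= a * r.\<close>
  moreover have "a * real r * \<delta> \<le> x r * \<delta>"
    using N_large[of r] k \<delta> by (intro mult_right_mono) (auto simp: N_def)
  moreover have "(\<Sum>i=1..k. w i * (x i / real i)) \<le> a * (\<Sum>i=1..k. w i)"
  proof -
    have "- w m \<le> - w (Suc m)" if "m < k" for m
      using that r by (auto simp: w_def intro!: frac_le)
    then show ?thesis
      using cheb[of "\<lambda>i. - w i"] by (simp add: sum_negf)
  qed
  moreover have "(\<Sum>i=1..k. w i * (x i / real i)) = (\<Sum>i=1..k. x i / real i) - (\<Sum>s=1..k. x s / real (r - s))"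
    unfolding sum_subtractf[symmetric]
    by (intro sum.cong) (auto simp: w_def left_diff_distrib diff_divide_distrib)
  \<comment> \<open>Both sides agree for the linear sequence \<open>x i = i\<close>, which makes the weights balance.\<close>
  moreover have "a * (\<Sum>i=1..k. w i) = (\<Sum>s=k+1..r-k-1. a * real s / real (r - s)) + a * real r * \<delta>"
  proof -
    have "(\<Sum>s=1..r-k-1. real s / real (r - s)) = (\<Sum>s=1..r-k-1. real r * (1 / real (r - s)) - 1)"
      using k by (intro sum.cong) (auto simp: field_simps of_nat_diff)
    also have "\<dots> = real r * (1 - \<delta> - 1 / real r) - real (r - k - 1)"
    proof -
      have "(\<Sum>s=1..r-k-1. 1 / real (r - s)) = 1 - \<delta> - 1 / real r"
        using harm' by linarith
      then show ?thesis
        unfolding sum_subtractf sum_distrib_left[symmetric] by simp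
    qed
    also have "\<dots> = real k - real r * \<delta>"
      using k by (simp add: algebra_simps of_nat_diff)
    finally have "(\<Sum>i=1..k. w i) = (\<Sum>s=k+1..r-k-1. real s / real (r - s)) + real r * \<delta>"
      unfolding split2 by (simp add: w_def sum_subtractf)
    then show ?thesis
      by (simp add: distrib_left sum_distrib_left mult.assoc)
  qed
  ultimately show ?thesis
    unfolding main right_diff_distrib by linarith
qed

text \<open>Apply t <= exp (t - 1) to t = r * x i / i; the exponents sum to r * (x 1 / 1 + ... + x r
  / r) - r <= 0. The scaling is chosen so that equality holds for x i = i / r.\<close>

lemma restricted_superadditive_prod_le:
  fixes x :: "nat \<Rightarrow> real"
  assumes "\<And>i j. \<lbrakk>1 \<le> i; i \<le> k; 1 \<le> j; i + j \<le> r\<rbrakk> \<Longrightarrow> x i + x j \<le> x (i + j)"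
    and "1 \<le> k" "k < r" "(\<Sum>j=k+1..r. 1 / real j) \<le> 1"
    and pos: "\<And>i. 0 \<le> x i" and xr: "x r = 1"
  shows "(\<Prod>i=1..r. x i) \<le> fact r / real r ^ r"
proof -
  have r: "0 < r" using assms(2,3) by simp
  have "(\<Prod>i=1..r. x i * (real r / real i)) \<le> (\<Prod>i=1..r. exp (x i * (real r / real i) - 1))"
    using pos exp_ge_add_one_self[of "x i * (real r / real i) - 1" for i]
    by (intro prod_mono) auto
  also have "\<dots> = exp (real r * (\<Sum>i=1..r. x i / real i) - real r)"
    by (simp add: exp_sum[symmetric] sum_subtractf sum_distrib_left mult_ac)
  also have "\<dots> \<le> 1"
    using restricted_superadditive_sum_le[of k r x, OF assms(1-4)] xr r by simp
  finally have "(\<Prod>i=1..r. x i) * (real r ^ r / fact r) \<le> 1"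
    by (simp add: prod.distrib prod_dividef fact_prod)
  then show ?thesis using r by (simp add: field_simps)
qed

text \<open>Each term satisfies 1/j <= ln j - ln (j - 1), and the right sides telescope.\<close>

lemma sum_inverse_le_ln:
  assumes "1 \<le> k" "k \<le> r"
  shows "(\<Sum>j=k+1..r. 1 / real j) \<le> ln (real r / real k)"
  using assms(2)
proof (induction r rule: dec_induct)
  case (step n)
  have "ln (1 - 1 / real (Suc n)) \<le> - 1 / real (Suc n)"
    using ln_le_minus_one[of "1 - 1 / real (Suc n)"] step assms by (simp add: field_simps)
  moreover have "1 - 1 / real (Suc n) = real n / real (Suc n)"
    by (simp add: field_simps)
  ultimately show ?case
    using step assms by (simp add: ln_div)
qed (use assms in simp)

section \<open>Entropy of a uniform random element of a set of tuples, expressed by counting\<close>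

section \<open>Entropy of symmetric sets of tuples\<close>

definition fiber :: "('i \<Rightarrow> 'a) set \<Rightarrow> 'i set \<Rightarrow> ('i \<Rightarrow> 'a) \<Rightarrow> ('i \<Rightarrow> 'a) set" where
  "fiber \<Omega> I f = {g \<in> \<Omega>. \<forall>a\<in>I. g a = f a}"

lemma mem_fiber: "g \<in> fiber \<Omega> I f \<longleftrightarrow> g \<in> \<Omega> \<and> (\<forall>a\<in>I. g a = f a)"
  by (simp add: fiber_def)

lemma finite_fiber: "finite \<Omega> \<Longrightarrow> finite (fiber \<Omega> I f)"
  by (simp add: fiber_def)

lemma fiber_cong: "(\<And>a. a \<in> I \<Longrightarrow> g a = f a) \<Longrightarrow> fiber \<Omega> I g = fiber \<Omega> I f"
  by (auto simp: fiber_def)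

lemma card_fiber_pos: "finite \<Omega> \<Longrightarrow> f \<in> \<Omega> \<Longrightarrow> 0 < card (fiber \<Omega> I f)"
  by (auto simp: card_gt_0_iff finite_fiber mem_fiber)

lemma fiber_insert: "fiber \<Omega> (insert p I) f = {g \<in> fiber \<Omega> I f. g p = f p}"
  by (auto simp: fiber_def)

text \<open>The tower property of conditional expectation: agreeing on I is an equivalence relation,
  so each g receives total weight 1 from the members of its own class.\<close>

lemma sum_fiber_average:
  fixes \<phi> :: "('i \<Rightarrow> 'a) \<Rightarrow> real"
  assumes fin: "finite \<Omega>"
  shows "(\<Sum>f\<in>\<Omega>. (\<Sum>g\<in>fiber \<Omega> I f. \<phi> g) / card (fiber \<Omega> I f)) = (\<Sum>f\<in>\<Omega>. \<phi> f)"
proof -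
  have "(\<Sum>f\<in>\<Omega>. (\<Sum>g\<in>fiber \<Omega> I f. \<phi> g) / card (fiber \<Omega> I f))
      = (\<Sum>f\<in>\<Omega>. \<Sum>g\<in>{g \<in> \<Omega>. \<forall>a\<in>I. g a = f a}. \<phi> g / card (fiber \<Omega> I f))"
    by (simp add: sum_divide_distrib fiber_def)
  also have "\<dots> = (\<Sum>g\<in>\<Omega>. \<Sum>f\<in>{f \<in> \<Omega>. \<forall>a\<in>I. g a = f a}. \<phi> g / card (fiber \<Omega> I f))"
    by (rule sum.swap_restrict) (use fin in auto)
  also have "\<dots> = (\<Sum>g\<in>\<Omega>. \<phi> g)"
  proof (rule sum.cong[OF refl])
    fix g assume g: "g \<in> \<Omega>"
    have "(\<Sum>f\<in>{f \<in> \<Omega>. \<forall>a\<in>I. g a = f a}. \<phi> g / card (fiber \<Omega> I f))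
        = (\<Sum>f\<in>fiber \<Omega> I g. \<phi> g / card (fiber \<Omega> I g))"
    proof (rule sum.cong)
      show "{f \<in> \<Omega>. \<forall>a\<in>I. g a = f a} = fiber \<Omega> I g" by (auto simp: fiber_def)
      fix f assume "f \<in> fiber \<Omega> I g"
      then show "\<phi> g / card (fiber \<Omega> I f) = \<phi> g / card (fiber \<Omega> I g)"
        by (subst fiber_cong[of I f g]) (auto simp: mem_fiber)
    qed
    then show "(\<Sum>f\<in>{f \<in> \<Omega>. \<forall>a\<in>I. g a = f a}. \<phi> g / card (fiber \<Omega> I f)) = \<phi> g"
      using card_fiber_pos[OF fin g, of I] by simp
  qed
  finally show ?thesis .
qed

text \<open>The elements of S with a given value of \<open>h\<close> share a total weight of
  1.\<close>

lemma sum_div_card_level: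
  fixes c :: "'b \<Rightarrow> real"
  assumes "finite S"
  shows "(\<Sum>x\<in>S. c (h x) / card {y \<in> S. h y = h x}) = (\<Sum>v\<in>h ` S. c v)"
proof -
  have "(\<Sum>x\<in>S. c (h x) / card {y \<in> S. h y = h x})
      = (\<Sum>v\<in>h ` S. \<Sum>x\<in>{x \<in> S. h x = v}. c (h x) / card {y \<in> S. h y = h x})"
    by (rule sum.image_gen) fact
  also have "\<dots> = (\<Sum>v\<in>h ` S. \<Sum>x\<in>{x \<in> S. h x = v}. c v / card {y \<in> S. h y = v})"
    by (intro sum.cong) auto
  also have "\<dots> = (\<Sum>v\<in>h ` S. c v)"
  proof (rule sum.cong[OF refl])
    fix v assume "v \<in> h ` S"
    then have "card {y \<in> S. h y = v} \<noteq> 0" using assms by auto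
    then show "(\<Sum>x\<in>{x \<in> S. h x = v}. c v / card {y \<in> S. h y = v}) = c v" by simp
  qed
  finally show ?thesis .
qed

text \<open>Jensen's inequality for ln, from the tangent line at the average.\<close>

lemma sum_ln_le_card_ln_average:
  assumes fin: "finite A" "A \<noteq> {}" and pos: "\<And>x. x \<in> A \<Longrightarrow> 0 < t x"
  shows "(\<Sum>x\<in>A. ln (t x)) \<le> card A * ln ((\<Sum>x\<in>A. t x) / card A)"
proof -
  define a where "a = (\<Sum>x\<in>A. t x) / card A"
  have n: "0 < card A" using fin by (simp add: card_gt_0_iff)
  have a: "0 < a" using n pos fin by (auto simp: a_def intro!: divide_pos_pos sum_pos)
  have "(\<Sum>x\<in>A. ln (t x) - ln a) \<le> (\<Sum>x\<in>A. t x / a - 1)"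
  proof (rule sum_mono)
    fix x assume "x \<in> A"
    then show "ln (t x) - ln a \<le> t x / a - 1"
      using ln_le_minus_one[of "t x / a"] pos[of x] a by (simp add: ln_div)
  qed
  also have "\<dots> = (\<Sum>x\<in>A. t x) / a - card A"
    by (simp add: sum_subtractf sum_divide_distrib)
  also have "\<dots> = 0"
    using n a unfolding a_def by (simp add: field_simps)
  finally show ?thesis by (simp add: sum_subtractf a_def)
qed

lemma ex_permutes_image:
  assumes "finite S" "I \<subseteq> S" "J \<subseteq> S" "card I = card J"
  shows "\<exists>\<pi>. \<pi> permutes S \<and> \<pi> ` I = J"
proof -
  have fin: "finite I" "finite J" using assms finite_subset by blast+
  obtain p where p: "bij_betw p I J"
    using finite_same_card_bij[OF fin assms(4)] by blast
  have "card (S - I) = card (S - J)" using assms fin by (simp add: card_Diff_subset)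
  then obtain q where q: "bij_betw q (S - I) (S - J)"
    using finite_same_card_bij[of "S - I" "S - J"] assms by blast
  define \<pi> where "\<pi> = (\<lambda>x. if x \<in> I then p x else if x \<in> S then q x else x)"
  have 1: "bij_betw \<pi> I J"
    using p by (subst bij_betw_cong[of I \<pi> p]) (auto simp: \<pi>_def)
  have 2: "bij_betw \<pi> (S - I) (S - J)"
    using q by (subst bij_betw_cong[of "S - I" \<pi> q]) (auto simp: \<pi>_def)
  have "bij_betw \<pi> (I \<union> (S - I)) (J \<union> (S - J))"
    by (rule bij_betw_combine[OF 1 2]) auto
  then have "bij_betw \<pi> S S" using assms by (simp add: Un_absorb1)
  then have "\<pi> permutes S"
    by (rule bij_imp_permutes) (use assms in \<open>auto simp: \<pi>_def\<close>)
  then show ?thesis using 1 by (auto simp: bij_betw_def)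
qed

text \<open>\<open>ext\<close> lets r coordinates determine a tuple, so counting functions counts
  tuples. \<open>sym\<close> makes the coordinates of a uniform random element exchangeable.\<close>

locale symmetric_tuples =
  fixes \<Omega> :: "(nat \<Rightarrow> 'a) set" and r :: nat
  assumes fin: "finite \<Omega>" and nonempty: "\<Omega> \<noteq> {}" and r_pos: "0 < r"
    and ext: "\<Omega> \<subseteq> extensional {..<r}"
    and sym: "\<lbrakk>\<pi> permutes {..<r}; f \<in> \<Omega>\<rbrakk> \<Longrightarrow> f \<circ> \<pi> \<in> \<Omega>"
begin

text \<open>\<open>card \<Omega>\<close> times the entropy of a uniform random tuple given its first
  s coordinates: under this condition the tuple is uniform on a fiber. So L s - L (s + 1) is
  \<open>card \<Omega>\<close> times the entropy of one coordinate given s others.\<close>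

definition L :: "nat \<Rightarrow> real" where
  "L s = (\<Sum>f\<in>\<Omega>. ln (card (fiber \<Omega> {..<s} f)))"

lemma card_pos: "0 < card \<Omega>"
  using fin nonempty by (simp add: card_gt_0_iff)

lemma bij_comp_permutation:
  assumes \<pi>: "\<pi> permutes {..<r}"
  shows "bij_betw (\<lambda>f. f \<circ> \<pi>) \<Omega> \<Omega>"
proof (rule bij_betw_byWitness[where f' = "\<lambda>f. f \<circ> inv \<pi>"])
  show "(\<lambda>f. f \<circ> \<pi>) ` \<Omega> \<subseteq> \<Omega>" "(\<lambda>f. f \<circ> inv \<pi>) ` \<Omega> \<subseteq> \<Omega>"
    using sym \<pi> permutes_inv[OF \<pi>] by blast+
qed (use permutes_inv_o[OF \<pi>] in \<open>auto simp: comp_assoc\<close>)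

lemma card_fiber_comp:
  assumes \<pi>: "\<pi> permutes {..<r}"
  shows "card (fiber \<Omega> I (f \<circ> \<pi>)) = card (fiber \<Omega> (\<pi> ` I) f)"
proof -
  have "bij_betw (\<lambda>g. g \<circ> \<pi>) (fiber \<Omega> (\<pi> ` I) f) (fiber \<Omega> I (f \<circ> \<pi>))"
  proof (rule bij_betw_imageI)
    show "inj_on (\<lambda>g. g \<circ> \<pi>) (fiber \<Omega> (\<pi> ` I) f)"
      by (rule inj_on_subset[OF bij_betw_imp_inj_on[OF bij_comp_permutation[OF \<pi>]]])
        (simp add: fiber_def)
    show "(\<lambda>g. g \<circ> \<pi>) ` fiber \<Omega> (\<pi> ` I) f = fiber \<Omega> I (f \<circ> \<pi>)" (is "?l = ?r")
    proof
      show "?l \<subseteq> ?r" using sym[OF \<pi>] by (auto simp: mem_fiber)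
      show "?r \<subseteq> ?l"
      proof
        fix h assume h: "h \<in> ?r"
        then have "h \<in> (\<lambda>g. g \<circ> \<pi>) ` \<Omega>"
          using bij_betw_imp_surj_on[OF bij_comp_permutation[OF \<pi>]] by (simp add: mem_fiber)
        then obtain g where "g \<in> \<Omega>" "h = g \<circ> \<pi>" by blast
        then show "h \<in> ?l" using h by (auto simp: mem_fiber)
      qed
    qed
  qed
  then show ?thesis by (simp add: bij_betw_same_card)
qed

text \<open>Exchangeability: re-indexing the sum by a permutation that carries the first
  \<open>card I\<close> indices to I shows that only the number of fixed coordinates
  matters.\<close>

lemma sum_ln_fiber:
  assumes "I \<subseteq> {..<r}"
  shows "(\<Sum>f\<in>\<Omega>. ln (card (fiber \<Omega> I f))) = L (card I)"
proof -
  have "card I \<le> r" using card_mono[OF _ assms] by simp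
  then obtain \<pi> where \<pi>: "\<pi> permutes {..<r}" "\<pi> ` {..<card I} = I"
    using ex_permutes_image[of "{..<r}" "{..<card I}" I] assms by auto
  have "L (card I) = (\<Sum>f\<in>\<Omega>. ln (card (fiber \<Omega> {..<card I} (f \<circ> \<pi>))))"
    unfolding L_def by (rule sum.reindex_bij_betw[OF bij_comp_permutation[OF \<pi>(1)], symmetric])
  then show ?thesis by (simp add: card_fiber_comp[OF \<pi>(1)] \<pi>(2))
qed

lemma L_0: "L 0 = card \<Omega> * ln (card \<Omega>)"
  by (simp add: L_def fiber_def)

lemma L_r: "L r = 0"
proof -
  have "fiber \<Omega> {..<r} f = {f}" if "f \<in> \<Omega>" for f
    using that ext by (auto simp: mem_fiber intro!: extensionalityI[of _ "{..<r}"])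
  then show ?thesis by (simp add: L_def)
qed

text \<open>Jensen for t f, the reciprocal of the probability of the value f 0. The mean of t is the
  number of values attained.\<close>

lemma marginal_entropy_le:
  assumes "finite V" "\<And>f. f \<in> \<Omega> \<Longrightarrow> f 0 \<in> V"
  shows "L 0 - L 1 \<le> card \<Omega> * ln (card V)"
proof -
  define t :: "(nat \<Rightarrow> 'a) \<Rightarrow> real" where "t = (\<lambda>f. card \<Omega> / card {g \<in> \<Omega>. g 0 = f 0})"
  have 0: "fiber \<Omega> {..<1} f = {g \<in> \<Omega>. g 0 = f 0}" for f
    by (auto simp: fiber_def)
  have pos: "0 < card {g \<in> \<Omega>. g 0 = f 0}" if "f \<in> \<Omega>" for f
    using card_fiber_pos[OF fin that, of "{..<1}"] unfolding 0 .
  have "L 0 - L 1 = (\<Sum>f\<in>\<Omega>. ln (t f))"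
    unfolding L_0 unfolding L_def 0 using pos card_pos by (simp add: t_def ln_div sum_subtractf)
  also have "\<dots> \<le> card \<Omega> * ln ((\<Sum>f\<in>\<Omega>. t f) / card \<Omega>)"
    using pos card_pos by (intro sum_ln_le_card_ln_average fin nonempty) (simp add: t_def)
  also have "(\<Sum>f\<in>\<Omega>. t f) = card \<Omega> * card ((\<lambda>f. f 0) ` \<Omega>)"
    unfolding t_def by (subst sum_div_card_level[OF fin, where h = "\<lambda>f. f 0"]) simp
  also have "\<dots> / card \<Omega> = card ((\<lambda>f. f 0) ` \<Omega>)"
    using card_pos by simp
  also have "card \<Omega> * ln \<dots> \<le> card \<Omega> * ln (card V)"
  proof -
    have "card ((\<lambda>f. f 0) ` \<Omega>) \<le> card V"
      using assms by (intro card_mono) auto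
    moreover have "0 < card ((\<lambda>f. f 0) ` \<Omega>)"
      using fin nonempty by (simp add: card_gt_0_iff)
    ultimately show ?thesis by (intro mult_left_mono) auto
  qed
  finally show ?thesis .
qed

text \<open>The exponential of the difference of the entropy of one coordinate given \<open>r - m\<close> others
  and the unconditional entropy of one coordinate, for a uniform random element of \<open>\<Omega>\<close>.\<close>

definition ratio :: "nat \<Rightarrow> real" where
  "ratio m = exp ((L (r - m) - L (r - m + 1) - (L 0 - L 1)) / card \<Omega>)"

text \<open>Chain rule: the conditional entropies telescope to the entropy ln (card \<Omega>) of the
  whole tuple.\<close>

lemma prod_ratio:
  "(\<Prod>m=1..r. ratio m) = card \<Omega> / exp (r * (L 0 - L 1) / card \<Omega>)"
proof -
  have "(\<Sum>m=1..r. L (r - m) - L (r - m + 1)) = (\<Sum>s<r. L s - L (Suc s))"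
    by (rule sum.reindex_bij_witness[of _ "\<lambda>s. r - s" "\<lambda>m. r - m"]) auto
  also have "\<dots> = L 0" by (subst sum_lessThan_telescope') (simp add: L_r)
  finally have "(\<Sum>m=1..r. (L (r - m) - L (r - m + 1) - (L 0 - L 1)) / card \<Omega>)
      = (L 0 - r * (L 0 - L 1)) / card \<Omega>"
    by (simp add: sum_divide_distrib[symmetric] sum_subtractf)
  then have "(\<Prod>m=1..r. ratio m) = exp (L 0 / card \<Omega> - r * (L 0 - L 1) / card \<Omega>)"
    unfolding ratio_def by (simp add: exp_sum[symmetric] diff_divide_distrib)
  moreover have "L 0 / card \<Omega> = ln (card \<Omega>)"
    using card_pos by (simp add: L_0)
  ultimately show ?thesis
    using card_pos by (simp add: exp_diff)
qed

text \<open>The summand is P(v)/Q(v) at v = f p, where P and Q are the laws of coordinate p given C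
  and given C with A. Averaging over Q first leaves the sum of P(v) over the support of Q, a
  conditional probability given C.\<close>

lemma sum_fiber_quotient:
  "(\<Sum>f\<in>\<Omega>. card (fiber \<Omega> (insert p C) f) * card (fiber \<Omega> (C \<union> A) f)
            / (card (fiber \<Omega> C f) * card (fiber \<Omega> (insert p (C \<union> A)) f)))
       = (\<Sum>f\<in>\<Omega>. card {h \<in> fiber \<Omega> C f. h p \<in> (\<lambda>g. g p) ` fiber \<Omega> (C \<union> A) f}
            / card (fiber \<Omega> C f))" (is "(\<Sum>f\<in>\<Omega>. ?t f) = _")
proof -
  have "(\<Sum>f\<in>\<Omega>. ?t f) = (\<Sum>f\<in>\<Omega>. (\<Sum>g\<in>fiber \<Omega> (C \<union> A) f. ?t g) / card (fiber \<Omega> (C \<union> A) f))"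
    by (rule sum_fiber_average[OF fin, symmetric])
  also have "\<dots> = (\<Sum>f\<in>\<Omega>. card {h \<in> fiber \<Omega> C f. h p \<in> (\<lambda>g. g p) ` fiber \<Omega> (C \<union> A) f}
            / card (fiber \<Omega> C f))"
  proof (rule sum.cong[OF refl])
    fix f assume f: "f \<in> \<Omega>"
    define F where "F = fiber \<Omega> (C \<union> A) f"
    define G where "G = fiber \<Omega> C f"
    have finF: "finite F" and finG: "finite G" unfolding F_def G_def by (simp_all add: finite_fiber fin)
    have "?t g = card {h \<in> G. h p = g p} / card {h \<in> F. h p = g p} * (card F / card G)" if "g \<in> F" for g
    proof -
      have "fiber \<Omega> C g = G" "fiber \<Omega> (C \<union> A) g = F"
        using that unfolding F_def G_def by (auto simp: mem_fiber intro!: fiber_cong)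
      then show ?thesis by (simp add: fiber_insert)
    qed
    then have "(\<Sum>g\<in>F. ?t g)
        = (\<Sum>g\<in>F. card {h \<in> G. h p = g p} / card {h \<in> F. h p = g p}) * (card F / card G)"
      unfolding sum_distrib_right by (intro sum.cong) auto
    also have "(\<Sum>g\<in>F. card {h \<in> G. h p = g p} / card {h \<in> F. h p = g p})
        = (\<Sum>v\<in>(\<lambda>g. g p) ` F. real (card {h \<in> G. h p = v}))"
      by (rule sum_div_card_level[OF finF, where h = "\<lambda>g. g p"])
    also have "\<dots> = card {h \<in> G. h p \<in> (\<lambda>g. g p) ` F}"
    proof -
      have "(\<Sum>v\<in>(\<lambda>g. g p) ` F. card {h \<in> G. h p = v})
         = (\<Sum>v\<in>(\<lambda>g. g p) ` F. \<Sum>h\<in>{h \<in> {h \<in> G. h p \<in> (\<lambda>g. g p) ` F}. h p = v}. 1)"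
        by (auto intro!: sum.cong arg_cong[where f = card])
      also have "\<dots> = (\<Sum>h\<in>{h \<in> G. h p \<in> (\<lambda>g. g p) ` F}. 1)"
        by (rule sum.group) (use finF finG in auto)
      finally show ?thesis by (simp flip: of_nat_sum)
    qed
    finally show "(\<Sum>g\<in>fiber \<Omega> (C \<union> A) f. ?t g) / card (fiber \<Omega> (C \<union> A) f)
       = card {h \<in> fiber \<Omega> C f. h p \<in> (\<lambda>g. g p) ` fiber \<Omega> (C \<union> A) f} / card (fiber \<Omega> C f)"
      using card_fiber_pos[OF fin f, of "C \<union> A"] unfolding F_def G_def by simp
  qed
  finally show ?thesis .
qed

text \<open>The left side is the exponential of H(X_p | C, A) - H(X_p | C), which is the mean of the
  logarithms of the summands on the right. Jensen moves the logarithm outside.\<close>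

lemma ratio_quotient_le:
  assumes I: "C \<union> A \<subseteq> {..<r}" "C \<inter> A = {}" "p < r" "p \<notin> C \<union> A"
    and "card C = r - n" "card (C \<union> A) = r - m" "n \<le> r"
  shows "ratio m / ratio n \<le>
    (\<Sum>f\<in>\<Omega>. card (fiber \<Omega> (insert p C) f) * card (fiber \<Omega> (C \<union> A) f)
            / (card (fiber \<Omega> C f) * card (fiber \<Omega> (insert p (C \<union> A)) f))) / card \<Omega>"
    (is "_ \<le> (\<Sum>f\<in>\<Omega>. ?t f) / _")
proof -
  have finI: "finite (C \<union> A)" using I(1) finite_subset by blast
  have pos: "0 < ?t f" if "f \<in> \<Omega>" for f
    using card_fiber_pos[OF fin that] by simp
  have "0 < (\<Sum>f\<in>\<Omega>. ?t f)"
    by (rule sum_pos[OF fin nonempty pos])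
  then have S: "0 < (\<Sum>f\<in>\<Omega>. ?t f) / card \<Omega>"
    using card_pos by simp
  have "(\<Sum>f\<in>\<Omega>. ln (?t f)) = (\<Sum>f\<in>\<Omega>. ln (card (fiber \<Omega> (insert p C) f)) + ln (card (fiber \<Omega> (C \<union> A) f))
      - ln (card (fiber \<Omega> C f)) - ln (card (fiber \<Omega> (insert p (C \<union> A)) f)))"
  proof (rule sum.cong[OF refl])
    fix f assume "f \<in> \<Omega>"
    then have "card (fiber \<Omega> I f) \<noteq> 0" for I using card_fiber_pos[OF fin] by simp
    then show "ln (?t f) = ln (card (fiber \<Omega> (insert p C) f)) + ln (card (fiber \<Omega> (C \<union> A) f))
      - ln (card (fiber \<Omega> C f)) - ln (card (fiber \<Omega> (insert p (C \<union> A)) f))"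
      by (simp add: ln_div ln_mult)
  qed
  also have "\<dots> = L (card (insert p C)) + L (card (C \<union> A)) - L (card C) - L (card (insert p (C \<union> A)))"
    using I by (simp add: sum_subtractf sum.distrib sum_ln_fiber)
  also have "\<dots> = L (r - n + 1) + L (r - m) - L (r - n) - L (r - m + 1)"
    using I finI assms(5,6) by simp
  finally have "(L (r - n + 1) + L (r - m) - L (r - n) - L (r - m + 1)) / card \<Omega>
      \<le> ln ((\<Sum>f\<in>\<Omega>. ?t f) / card \<Omega>)"
    using sum_ln_le_card_ln_average[OF fin nonempty, of ?t] pos card_pos by (simp add: field_simps)
  then have "exp ((L (r - n + 1) + L (r - m) - L (r - n) - L (r - m + 1)) / card \<Omega>)
      \<le> (\<Sum>f\<in>\<Omega>. ?t f) / card \<Omega>"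
    unfolding ln_ge_iff[OF S] .
  moreover have "ratio m / ratio n = exp ((L (r - n + 1) + L (r - m) - L (r - n) - L (r - m + 1)) / card \<Omega>)"
    by (simp add: ratio_def exp_diff[symmetric] diff_divide_distrib[symmetric])
  ultimately show ?thesis by simp
qed

text \<open>After division by the right side, the two terms are at most the mean probabilities,
  given C, that coordinate p hits its support given C and A, and that coordinate q hits its support
  given C and B. The supports are disjoint and p, q are exchangeable given C, so these probabilities
  add up to at most 1.\<close>

lemma ratio_superadditive:
  assumes part: "{..<r} = C \<union> A \<union> B" "C \<inter> A = {}" "C \<inter> B = {}" "A \<inter> B = {}"
    and p: "p \<in> B" and q: "q \<in> A"
    and disj: "\<And>f g h. \<lbrakk>f \<in> \<Omega>; g \<in> fiber \<Omega> (C \<union> A) f; h \<in> fiber \<Omega> (C \<union> B) f\<rbrakk> \<Longrightarrow> g p \<noteq> h q"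
  shows "ratio (card B) + ratio (card A) \<le> ratio (card A + card B)"
proof -
  have fins: "finite A" "finite B" "finite C"
    using part(1) finite_subset[of _ "{..<r}"] by blast+
  have cr: "card C + card A + card B = r"
  proof -
    have "r = card (C \<union> A \<union> B)" using part(1) by (metis card_lessThan)
    then show ?thesis using part fins by (simp add: card_Un_disjoint Int_Un_distrib2)
  qed
  have cCA: "card (C \<union> A) = r - card B" "card (C \<union> B) = r - card A" "card C = r - (card A + card B)"
    using cr fins part by (simp_all add: card_Un_disjoint)
  define N where "N = (\<lambda>p I f. (\<lambda>g::nat \<Rightarrow> 'a. g p) ` fiber \<Omega> I f)"
  let ?n = "card A + card B"
  have pq: "p < r" "q < r" "p \<notin> C \<union> A" "q \<notin> C \<union> B" using p q part by auto
  have 1: "ratio (card B) / ratio ?n \<le>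
      (\<Sum>f\<in>\<Omega>. card {h \<in> fiber \<Omega> C f. h p \<in> N p (C \<union> A) f} / card (fiber \<Omega> C f)) / card \<Omega>"
    using ratio_quotient_le[of C A p ?n "card B"] sum_fiber_quotient[of p C A] part cCA cr pq
    by (auto simp: N_def)
  have 2: "ratio (card A) / ratio ?n \<le>
      (\<Sum>f\<in>\<Omega>. card {h \<in> fiber \<Omega> C f. h q \<in> N q (C \<union> B) f} / card (fiber \<Omega> C f)) / card \<Omega>"
    using ratio_quotient_le[of C B q ?n "card A"] sum_fiber_quotient[of q C B] part cCA cr pq
    by (auto simp: N_def)
  have "(\<Sum>f\<in>\<Omega>. card {h \<in> fiber \<Omega> C f. h p \<in> N p (C \<union> A) f} / card (fiber \<Omega> C f)
     + card {h \<in> fiber \<Omega> C f. h q \<in> N q (C \<union> B) f} / card (fiber \<Omega> C f)) \<le> (\<Sum>f\<in>\<Omega>. 1)"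
    (is "(\<Sum>f\<in>\<Omega>. ?s f + ?u f) \<le> _")
  proof (rule sum_mono)
    fix f assume f: "f \<in> \<Omega>"
    define G where "G = fiber \<Omega> C f"
    \<comment> \<open>Swapping p and q fixes C pointwise, so the event about coordinate q becomes
      one about p, disjoint from the other.\<close>
    define \<pi> where "\<pi> = transpose p q"
    have \<pi>: "\<pi> permutes {..<r}" using pq by (auto simp: \<pi>_def intro: permutes_swap_id)
    have finG: "finite G" by (simp add: G_def finite_fiber fin)
    have "card {h \<in> G. h q \<in> N q (C \<union> B) f} \<le> card {h \<in> G. h p \<in> N q (C \<union> B) f}"
    proof (rule card_inj_on_le[where f = "\<lambda>h. h \<circ> \<pi>"])
      show "inj_on (\<lambda>h. h \<circ> \<pi>) {h \<in> G. h q \<in> N q (C \<union> B) f}"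
        by (rule inj_on_subset[OF bij_betw_imp_inj_on[OF bij_comp_permutation[OF \<pi>]]])
          (auto simp: G_def mem_fiber)
      have "\<pi> a = a" if "a \<in> C" for a
        using that pq by (auto simp: \<pi>_def transpose_def)
      then show "(\<lambda>h. h \<circ> \<pi>) ` {h \<in> G. h q \<in> N q (C \<union> B) f} \<subseteq> {h \<in> G. h p \<in> N q (C \<union> B) f}"
        using sym[OF \<pi>] by (auto simp: G_def mem_fiber) (simp add: \<pi>_def)
    qed (use finG in auto)
    moreover have "card {h \<in> G. h p \<in> N p (C \<union> A) f} + card {h \<in> G. h p \<in> N q (C \<union> B) f}
        = card ({h \<in> G. h p \<in> N p (C \<union> A) f} \<union> {h \<in> G. h p \<in> N q (C \<union> B) f})"
    proof (rule card_Un_disjoint[symmetric])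
      have "N p (C \<union> A) f \<inter> N q (C \<union> B) f = {}"
      proof (rule equals0I, elim IntE)
        fix v assume "v \<in> N p (C \<union> A) f" "v \<in> N q (C \<union> B) f"
        then obtain g h where "g \<in> fiber \<Omega> (C \<union> A) f" "v = g p" "h \<in> fiber \<Omega> (C \<union> B) f" "v = h q"
          unfolding N_def by blast
        then show False using disj[OF f, of g h] by simp
      qed
      then show "{h \<in> G. h p \<in> N p (C \<union> A) f} \<inter> {h \<in> G. h p \<in> N q (C \<union> B) f} = {}"
        by blast
    qed (simp_all add: finG)
    moreover have "\<dots> \<le> card G" by (intro card_mono finG) auto
    ultimately have "real (card {h \<in> G. h p \<in> N p (C \<union> A) f}) + card {h \<in> G. h q \<in> N q (C \<union> B) f} \<le> card G"
      by linarith
    moreover have "0 < card G" unfolding G_def by (rule card_fiber_pos[OF fin f])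
    ultimately show "card {h \<in> fiber \<Omega> C f. h p \<in> N p (C \<union> A) f} / card (fiber \<Omega> C f)
     + card {h \<in> fiber \<Omega> C f. h q \<in> N q (C \<union> B) f} / card (fiber \<Omega> C f) \<le> 1"
      unfolding G_def by (simp add: add_divide_distrib[symmetric])
  qed
  then have "(\<Sum>f\<in>\<Omega>. ?s f) / card \<Omega> + (\<Sum>f\<in>\<Omega>. ?u f) / card \<Omega> \<le> 1"
    using card_pos unfolding sum.distrib by (simp flip: add_divide_distrib)
  then have "ratio (card B) / ratio ?n + ratio (card A) / ratio ?n \<le> 1"
    using 1 2 by linarith
  moreover have "0 < ratio ?n" by (simp add: ratio_def)
  ultimately show ?thesis by (simp add: field_simps)
qed

end

lemma binomial_le_power: "n choose s \<le> n ^ s"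
proof -
  have "(n choose s) * 1 \<le> (n choose s) * fact s" by (intro mult_left_mono) auto
  also note binomial_fact_pow
  finally show ?thesis by simp
qed

section \<open>The entropy bound for hypergraphs in which no edge split has a common extending
  vertex\<close>

section \<open>Hypergraphs without homomorphic images of tents\<close>

text \<open>For r-uniform E these are the r! orderings of every edge, since a map from r indices
  onto an r-set is a bijection.\<close>

definition ordered_edges :: "nat \<Rightarrow> 'a set set \<Rightarrow> (nat \<Rightarrow> 'a) set" where
  "ordered_edges r E = {f \<in> extensional {..<r}. f ` {..<r} \<in> E}"

lemma finite_ordered_edges:
  assumes "finite V" "\<And>e. e \<in> E \<Longrightarrow> e \<subseteq> V"
  shows "finite (ordered_edges r E)"
proof (rule finite_subset)
  show "ordered_edges r E \<subseteq> {..<r} \<rightarrow>\<^sub>E V"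
  proof
    fix f assume f: "f \<in> ordered_edges r E"
    then have "f ` {..<r} \<subseteq> V" using assms(2) by (simp add: ordered_edges_def)
    then show "f \<in> {..<r} \<rightarrow>\<^sub>E V" using f by (auto simp: ordered_edges_def PiE_def)
  qed
qed (use assms(1) in \<open>simp add: finite_PiE\<close>)

lemma inj_on_ordered_edge:
  assumes "f \<in> ordered_edges r E" "\<And>e. e \<in> E \<Longrightarrow> card e = r"
  shows "inj_on f {..<r}"
  using assms by (auto simp: ordered_edges_def intro!: eq_card_imp_inj_on)

lemma card_ordered_edges_ge:
  assumes V: "finite V" and E: "\<And>e. e \<in> E \<Longrightarrow> e \<subseteq> V \<and> card e = r"
  shows "fact r * card E \<le> card (ordered_edges r E)"
proof -
  have "\<exists>b. bij_betw b {..<r} e" if "e \<in> E" for e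
    using finite_same_card_bij[of "{..<r}" e] E[OF that] V finite_subset by auto
  then obtain b where b: "\<And>e. e \<in> E \<Longrightarrow> bij_betw (b e) {..<r} e" by metis
  let ?F = "\<lambda>(e, \<pi>). restrict (b e \<circ> \<pi>) {..<r}"
  have img: "?F (e, \<pi>) ` {..<r} = e" if "e \<in> E" "\<pi> permutes {..<r}" for e \<pi>
  proof -
    have "?F (e, \<pi>) ` {..<r} = b e ` \<pi> ` {..<r}" by (simp add: image_image)
    then show ?thesis using bij_betw_imp_surj_on[OF b[OF that(1)]] permutes_image[OF that(2)] by simp
  qed
  have "card (E \<times> {\<pi>. \<pi> permutes {..<r}}) \<le> card (ordered_edges r E)"
  proof (rule card_inj_on_le[where f = ?F])
    show "inj_on ?F (E \<times> {\<pi>. \<pi> permutes {..<r}})"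
    proof (rule inj_onI, clarify)
      fix e \<pi> e' \<pi>'
      assume *: "e \<in> E" "\<pi> permutes {..<r}" "e' \<in> E" "\<pi>' permutes {..<r}"
        and eq: "restrict (b e \<circ> \<pi>) {..<r} = restrict (b e' \<circ> \<pi>') {..<r}"
      have e: "e = e'" using img[OF *(1,2)] img[OF *(3,4)] eq by simp
      have "\<pi> x = \<pi>' x" for x
      proof (cases "x \<in> {..<r}")
        case True
        then have "b e (\<pi> x) = b e (\<pi>' x)" using eq e by (metis comp_apply restrict_apply')
        moreover have "\<pi> x \<in> {..<r}" "\<pi>' x \<in> {..<r}"
          using True permutes_in_image[OF *(2)] permutes_in_image[OF *(4)] by blast+
        ultimately show ?thesis
          using bij_betw_imp_inj_on[OF b[OF *(1)]] by (simp add: inj_on_eq_iff)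
      next
        case False
        then show ?thesis using *(2,4) by (simp add: permutes_def)
      qed
      with e show "e = e' \<and> \<pi> = \<pi>'" by auto
    qed
    show "?F ` (E \<times> {\<pi>. \<pi> permutes {..<r}}) \<subseteq> ordered_edges r E"
      using img by (auto simp: ordered_edges_def)
    show "finite (ordered_edges r E)"
      using V E by (intro finite_ordered_edges) auto
  qed
  then show ?thesis by (simp add: card_cartesian_product card_permutations[where n = r] mult.commute)
qed

text \<open>For \<open>r\<close>-uniform \<open>E\<close>: no homomorphic image of the \<open>(r - i, i)\<close>-tent occurs in \<open>E\<close>.\<close>

definition link_disjoint :: "nat \<Rightarrow> 'a set set \<Rightarrow> bool" where
  "link_disjoint i E \<longleftrightarrow>
     (\<forall>A B v. A \<inter> B = {} \<and> A \<union> B \<in> E \<and> card B = i \<and> v \<notin> A \<union> B \<longrightarrow>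
        \<not> ((\<exists>e\<in>E. insert v A \<subseteq> e) \<and> (\<exists>e\<in>E. insert v B \<subseteq> e)))"

text \<open>By the chain rule the number of ordered edges is the product of the ratios times the
  r-th power of exp H, with H the entropy of one vertex and H <= ln (card V). The r! orderings of
  each edge cancel the r! of the product bound.\<close>

lemma card_link_disjoint_le:
  fixes E :: "'a set set"
  assumes V: "finite V" and E: "\<And>e. e \<in> E \<Longrightarrow> e \<subseteq> V \<and> card e = r"
    and k: "1 \<le> k" "k < r" "(\<Sum>j=k+1..r. 1 / real j) \<le> 1"
    and link: "\<And>i. \<lbrakk>1 \<le> i; i \<le> k\<rbrakk> \<Longrightarrow> link_disjoint i E"
  shows "real (card E) \<le> (real (card V) / real r) ^ r"
proof (cases "E = {}")
  case False
  define \<Omega> where "\<Omega> = ordered_edges r E"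
  have inj: "inj_on f {..<r}" and edge: "f ` {..<r} \<in> E" if "f \<in> \<Omega>" for f
    using that inj_on_ordered_edge[of f r E] E by (auto simp: \<Omega>_def ordered_edges_def)
  have ge: "fact r * card E \<le> card \<Omega>"
    unfolding \<Omega>_def by (rule card_ordered_edges_ge[OF V E])
  have "finite E" using V E by (auto intro: finite_subset[of E "Pow V"])
  then have "0 < fact r * card E" using False by (simp add: card_gt_0_iff)
  then have "0 < card \<Omega>" using ge by linarith
  interpret symmetric_tuples \<Omega> r
  proof
    show "finite \<Omega>" "\<Omega> \<noteq> {}" using \<open>0 < card \<Omega>\<close> by (auto simp: card_gt_0_iff)
    show "0 < r" using k by simp
    show "\<Omega> \<subseteq> extensional {..<r}" by (auto simp: \<Omega>_def ordered_edges_def)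
    fix \<pi> f assume \<pi>: "\<pi> permutes {..<r}" and f: "f \<in> \<Omega>"
    have "f \<circ> \<pi> \<in> extensional {..<r}"
      using f \<pi> by (auto simp: \<Omega>_def ordered_edges_def extensional_def permutes_def)
    moreover have "(f \<circ> \<pi>) ` {..<r} = f ` {..<r}"
      unfolding image_comp[symmetric] permutes_image[OF \<pi>] ..
    ultimately show "f \<circ> \<pi> \<in> \<Omega>" using f by (simp add: \<Omega>_def ordered_edges_def)
  qed
  have "(\<Prod>m=1..r. ratio m) \<le> fact r / real r ^ r"
  proof (rule restricted_superadditive_prod_le[OF _ k])
    fix i j :: nat assume ij: "1 \<le> i" "i \<le> k" "1 \<le> j" "i + j \<le> r"
    \<comment> \<open>Consecutive blocks of lengths r-i-j, j and i; the last indices of B and A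
      serve as the coordinates to be compared.\<close>
    define C A B where "C = {..<r-i-j}" and "A = {r-i-j..<r-i}" and "B = {r-i..<r}"
    have part: "{..<r} = C \<union> A \<union> B" "C \<inter> A = {}" "C \<inter> B = {}" "A \<inter> B = {}"
      using ij by (auto simp: C_def A_def B_def)
    have cards: "card A = j" "card B = i" using ij by (auto simp: A_def B_def)
    have mem: "r - 1 \<in> B" "r - i - 1 \<in> A" using ij by (auto simp: A_def B_def)
    have "ratio (card B) + ratio (card A) \<le> ratio (card A + card B)"
    proof (rule ratio_superadditive[OF part mem])
      fix f g h
      assume f: "f \<in> \<Omega>" and "g \<in> fiber \<Omega> (C \<union> A) f" "h \<in> fiber \<Omega> (C \<union> B) f"
      then have g: "g \<in> \<Omega>" "g ` (C \<union> A) = f ` (C \<union> A)" and h: "h \<in> \<Omega>" "h ` (C \<union> B) = f ` (C \<union> B)"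
        by (auto simp: mem_fiber intro!: image_cong)
      show "g (r - 1) \<noteq> h (r - i - 1)"
      proof
        assume eq: "g (r - 1) = h (r - i - 1)"
        \<comment> \<open>This v would extend both parts of the edge given by f: g yields an edge
          through v and the images of C and A, h one through v and the image of B. As B has i
          elements, \<open>link_disjoint i\<close> excludes this.\<close>
        define v where "v = g (r - 1)"
        have "v \<notin> g ` (C \<union> A)"
          unfolding v_def using inj_on_image_mem_iff[OF inj[OF g(1)], of "r - 1" "C \<union> A"] part mem by auto
        then have vA: "v \<notin> f ` (C \<union> A)" using g(2) by simp
        have "v \<notin> h ` (C \<union> B)"
          unfolding v_def eq using inj_on_image_mem_iff[OF inj[OF h(1)], of "r - i - 1" "C \<union> B"] part mem by auto
        then have vB: "v \<notin> f ` (C \<union> B)" using h(2) by simp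
        have 1: "insert v (f ` (C \<union> A)) \<subseteq> g ` {..<r}"
          unfolding g(2)[symmetric] v_def using part mem by auto
        have 2: "insert v (f ` B) \<subseteq> h ` {..<r}"
        proof -
          have "f ` B \<subseteq> h ` (C \<union> B)" unfolding h(2) by blast
          moreover have "v \<in> h ` {..<r}" unfolding v_def eq using part mem by blast
          ultimately show ?thesis using part(1) by blast
        qed
        have un: "f ` (C \<union> A) \<union> f ` B = f ` {..<r}" using part(1) by blast
        have "f ` (C \<union> A) \<inter> f ` B = f ` ((C \<union> A) \<inter> B)"
          by (rule inj_on_image_Int[OF inj[OF f], symmetric]) (use part in auto)
        also have "\<dots> = {}" using part by blast
        finally have dis: "f ` (C \<union> A) \<inter> f ` B = {}" .
        have cB: "card (f ` B) = i"
          using card_image[OF inj_on_subset[OF inj[OF f]], of B] part(1) cards by auto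
        have "v \<notin> f ` (C \<union> A) \<union> f ` B" using vA vB by blast
        then have "\<not> ((\<exists>e\<in>E. insert v (f ` (C \<union> A)) \<subseteq> e) \<and> (\<exists>e\<in>E. insert v (f ` B) \<subseteq> e))"
          using link[OF ij(1,2), unfolded link_disjoint_def, rule_format, of "f ` (C \<union> A)" "f ` B" v]
            dis edge[OF f] cB unfolding un by blast
        then show False using 1 2 edge[OF g(1)] edge[OF h(1)] by blast
      qed
    qed
    then show "ratio i + ratio j \<le> ratio (i + j)" by (simp add: cards add.commute)
  qed (simp_all add: ratio_def)
  then have 1: "card \<Omega> / exp (r * (L 0 - L 1) / card \<Omega>) \<le> fact r / real r ^ r"
    unfolding prod_ratio .
  have V0: "f 0 \<in> V" if "f \<in> \<Omega>" for f using edge[OF that] E r_pos by blast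
  have "V \<noteq> {}" using nonempty V0 by blast
  then have n: "0 < card V" using V by (simp add: card_gt_0_iff)
  have "(L 0 - L 1) / card \<Omega> \<le> ln (card V)"
    using marginal_entropy_le[of V] V V0 card_pos by (simp add: field_simps)
  then have "r * ((L 0 - L 1) / card \<Omega>) \<le> r * ln (card V)"
    by (intro mult_left_mono) auto
  then have "exp (r * (L 0 - L 1) / card \<Omega>) \<le> exp (r * ln (card V))" by simp
  also have "\<dots> = card V ^ r" using n by (simp add: exp_of_nat_mult)
  finally have 2: "exp (r * (L 0 - L 1) / card \<Omega>) \<le> real (card V) ^ r" by simp
  have "fact r * card E \<le> real (card \<Omega>)" using ge by (metis of_nat_fact of_nat_le_iff of_nat_mult)
  also have "\<dots> \<le> fact r / real r ^ r * exp (r * (L 0 - L 1) / card \<Omega>)"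
    using 1 by (simp add: pos_divide_le_eq)
  also have "\<dots> \<le> fact r / real r ^ r * real (card V) ^ r"
    by (rule mult_left_mono[OF 2]) simp
  finally have "fact r * real (card E) \<le> fact r * (real (card V) ^ r / real r ^ r)"
    by simp
  then have "real (card E) \<le> real (card V) ^ r / real r ^ r"
    by (simp only: mult_le_cancel_left_pos fact_gt_zero)
  then show ?thesis by (simp add: power_divide)
qed simp

section \<open>Cleaning by codegrees, and freely chosen edges through a covered set\<close>

section \<open>From tent-free hypergraphs to tent-hom-free ones\<close>

text \<open>The threshold is K times the bound n^(r-1-|S|) on the number of edges through S and one
  further vertex, so fewer than K vertices will not block S. At most n^s sets have size s, so the
  thresholds for each size sum to at most K * n^(r-1).\<close>

lemma ex_codegree_cleaned:
  fixes E :: "'a set set"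
  assumes V: "finite V" and E: "\<And>e. e \<in> E \<Longrightarrow> e \<subseteq> V \<and> card e = r"
  shows "\<exists>E'\<subseteq>E. card E \<le> card E' + K * r * card V ^ (r - 1) \<and>
     (\<forall>S. S \<noteq> {} \<and> card S < r \<and> (\<exists>e\<in>E'. S \<subseteq> e) \<longrightarrow>
        K * card V ^ (r - 1 - card S) \<le> card {e \<in> E'. S \<subseteq> e})"
proof -
  define n where "n = card V"
  define w where "w = (\<lambda>S::'a set. int (K * n ^ (r - 1 - card S)))"
  define \<S> where "\<S> = (\<lambda>F. {S. S \<subseteq> V \<and> S \<noteq> {} \<and> card S < r \<and> (\<exists>e\<in>F. S \<subseteq> e)})"
  \<comment> \<open>Maximise the number of edges minus the weights of the sets still covered: deleting all edges
    through a set of too small degree would increase this quantity.\<close>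
  define \<Phi> where "\<Phi> = (\<lambda>F. int (card F) - (\<Sum>S\<in>\<S> F. w S))"
  have finE: "finite E" using V E by (auto intro: finite_subset[of E "Pow V"])
  have fin\<S>: "finite (\<S> F)" for F using V by (simp add: \<S>_def)
  have "Max (\<Phi> ` Pow E) \<in> \<Phi> ` Pow E" by (rule Max_in) (use finE in auto)
  then obtain E' where E': "E' \<subseteq> E" "\<Phi> E' = Max (\<Phi> ` Pow E)" by auto
  have max: "\<Phi> F \<le> \<Phi> E'" if "F \<subseteq> E" for F
    unfolding E'(2) by (rule Max_ge) (use finE that in auto)
  have finE': "finite E'" using E' finE finite_subset by blast
  have "K * n ^ (r - 1 - card S) \<le> card {e \<in> E'. S \<subseteq> e}"
    if S: "S \<noteq> {}" "card S < r" "\<exists>e\<in>E'. S \<subseteq> e" for S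
  proof -
    define F where "F = {e \<in> E'. \<not> S \<subseteq> e}"
    have "card {e \<in> E'. S \<subseteq> e} + card F = card E'"
      unfolding F_def using finE' by (subst card_Un_disjoint[symmetric]) (auto intro: arg_cong[where f = card])
    moreover have "(\<Sum>T\<in>\<S> F. w T) + w S \<le> (\<Sum>T\<in>\<S> E'. w T)"
    proof -
      have "S \<in> \<S> E'" using S E'(1) E unfolding \<S>_def by blast
      moreover have "\<S> F \<subseteq> \<S> E' - {S}" by (auto simp: \<S>_def F_def)
      then have "(\<Sum>T\<in>\<S> F. w T) \<le> (\<Sum>T\<in>\<S> E' - {S}. w T)"
        by (intro sum_mono2) (auto simp: fin\<S> w_def)
      ultimately show ?thesis using sum.remove[OF fin\<S>, of S E' w] by simp
    qed
    moreover have "\<Phi> F \<le> \<Phi> E'" using E' by (intro max) (auto simp: F_def)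
    ultimately have "w S \<le> int (card {e \<in> E'. S \<subseteq> e})"
      unfolding \<Phi>_def by linarith
    then show ?thesis unfolding w_def by (simp only: of_nat_le_iff)
  qed
  \<comment> \<open>Compare E' with E itself: the penalties in \<Phi> E total at most r * K *
    n^(r-1), while \<Phi> E' is at most the number of edges of E'.\<close>
  moreover have "card E \<le> card E' + K * r * n ^ (r - 1)"
  proof -
    let ?P = "\<lambda>s. {S. S \<subseteq> V \<and> card S = s}"
    have "(\<Sum>S\<in>\<S> E. w S) \<le> (\<Sum>S\<in>(\<Union>s\<in>{1..<r}. ?P s). w S)"
    proof (rule sum_mono2)
      show "\<S> E \<subseteq> (\<Union>s\<in>{1..<r}. ?P s)"
      proof
        fix S assume "S \<in> \<S> E"
        then have S: "S \<subseteq> V" "S \<noteq> {}" "card S < r" by (simp_all add: \<S>_def)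
        moreover have "0 < card S" using S V by (simp add: card_gt_0_iff finite_subset)
        ultimately show "S \<in> (\<Union>s\<in>{1..<r}. ?P s)" by simp
      qed
    qed (use V in \<open>auto simp: w_def\<close>)
    also have "\<dots> = (\<Sum>s\<in>{1..<r}. \<Sum>S\<in>?P s. w S)"
      by (rule sum.UNION_disjoint) (use V in auto)
    also have "\<dots> = (\<Sum>s\<in>{1..<r}. int ((n choose s) * (K * n ^ (r - 1 - s))))"
      using V by (intro sum.cong) (auto simp: w_def n_subsets n_def)
    also have "\<dots> \<le> (\<Sum>s\<in>{1..<r}. int (K * n ^ (r - 1)))"
    proof (rule sum_mono)
      fix s assume s: "s \<in> {1..<r}"
      have "(n choose s) * (K * n ^ (r - 1 - s)) \<le> n ^ s * (K * n ^ (r - 1 - s))"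
        by (intro mult_right_mono binomial_le_power) simp
      also have "\<dots> = K * n ^ (s + (r - 1 - s))" unfolding power_add by simp
      also have "s + (r - 1 - s) = r - 1" using s by simp
      finally show "int ((n choose s) * (K * n ^ (r - 1 - s))) \<le> int (K * n ^ (r - 1))"
        by (simp only: of_nat_le_iff)
    qed
    also have "\<dots> = int ((r - 1) * (K * n ^ (r - 1)))" by simp
    also have "\<dots> \<le> int (r * (K * n ^ (r - 1)))"
      unfolding of_nat_le_iff by (intro mult_right_mono) auto
    finally have "int (card E) - int (r * (K * n ^ (r - 1))) \<le> \<Phi> E"
      unfolding \<Phi>_def by linarith
    also have "\<dots> \<le> \<Phi> E'" by (rule max) simp
    also have "\<dots> \<le> int (card E')"
      unfolding \<Phi>_def by (simp add: sum_nonneg w_def)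
    finally have "card E \<le> card E' + r * (K * n ^ (r - 1))" by linarith
    then show ?thesis by (simp add: mult_ac)
  qed
  ultimately show ?thesis using E'(1) unfolding n_def by blast
qed

text \<open>Union bound: each vertex of W lies in at most n^(r-1-|S|) of the edges through S, and W
  has fewer than K vertices.\<close>

lemma ex_avoiding_edge:
  fixes E :: "'a set set"
  assumes V: "finite V" and E: "\<And>e. e \<in> E \<Longrightarrow> e \<subseteq> V \<and> card e = r"
    and deg: "\<And>S. \<lbrakk>S \<noteq> {}; card S < r; \<exists>e\<in>E. S \<subseteq> e\<rbrakk> \<Longrightarrow>
      K * card V ^ (r - 1 - card S) \<le> card {e \<in> E. S \<subseteq> e}"
    and S: "S \<noteq> {}" "e \<in> E" "S \<subseteq> e" and W: "finite W" "card W < K" "W \<inter> S = {}"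
  shows "\<exists>e'\<in>E. S \<subseteq> e' \<and> e' \<inter> W = {}"
proof (cases "card S = r")
  \<comment> \<open>The codegree condition stops below size r, but here S is an edge and avoids W
    itself.\<close>
  case True
  then have "S = e" using S E V by (metis card_subset_eq finite_subset)
  then show ?thesis using S W by blast
next
  case False
  define n where "n = card V"
  define s where "s = r - 1 - card S"
  have fe: "finite e" "card e = r" "e \<subseteq> V" using E[OF S(2)] V finite_subset by auto
  then have "card S \<le> r" using card_mono[OF fe(1) S(3)] by simp
  then have cS: "card S < r" using False by simp
  have finS: "finite S" using S fe finite_subset by blast
  have n: "0 < n" using S fe V unfolding n_def by (auto simp: card_gt_0_iff)
  have finE: "finite E" using V E by (auto intro: finite_subset[of E "Pow V"])
  show ?thesis
  proof (rule ccontr)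
    assume "\<not> ?thesis"
    then have sub: "{e \<in> E. S \<subseteq> e} \<subseteq> (\<Union>u\<in>W. {e \<in> E. insert u S \<subseteq> e})"
      by (auto simp: disjoint_iff)
    have le: "card {e \<in> E. insert u S \<subseteq> e} \<le> n ^ s" if "u \<in> W" for u
    proof -
      have uS: "u \<notin> S" using that W by blast
      have "card {e \<in> E. insert u S \<subseteq> e} \<le> card {T. T \<subseteq> V \<and> card T = s}"
      proof (rule card_inj_on_le[where f = "\<lambda>e. e - insert u S"])
        show "inj_on (\<lambda>e. e - insert u S) {e \<in> E. insert u S \<subseteq> e}"
          by (auto simp: inj_on_def)
        have "card (e - insert u S) = s" if "e \<in> E" "insert u S \<subseteq> e" for e
          using E[OF that(1)] that(2) finS uS by (subst card_Diff_subset) (auto simp: s_def)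
        then show "(\<lambda>e. e - insert u S) ` {e \<in> E. insert u S \<subseteq> e} \<subseteq> {T. T \<subseteq> V \<and> card T = s}"
          using E by auto
      qed (use V in simp)
      also have "\<dots> \<le> n ^ s"
        unfolding n_subsets[OF V] n_def[symmetric] by (rule binomial_le_power)
      finally show ?thesis .
    qed
    have "K * n ^ s \<le> card {e \<in> E. S \<subseteq> e}"
      unfolding n_def s_def using S cS by (intro deg) auto
    also have "\<dots> \<le> card (\<Union>u\<in>W. {e \<in> E. insert u S \<subseteq> e})"
      by (rule card_mono[OF _ sub]) (use finE W in auto)
    also have "\<dots> \<le> (\<Sum>u\<in>W. card {e \<in> E. insert u S \<subseteq> e})"
      by (rule card_UN_le[OF W(1)])
    also have "\<dots> \<le> (\<Sum>u\<in>W. n ^ s)" by (rule sum_mono[OF le])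
    also have "\<dots> = card W * n ^ s" by simp
    also have "\<dots> < K * n ^ s" using W n by simp
    finally show False by simp
  qed
qed

section \<open>Embedding a tent block by block\<close>

lemma ex_inj_matching_pieces:
  fixes D :: "nat \<Rightarrow> 'b set" and T :: "nat \<Rightarrow> 'a set"
  assumes D: "\<And>j l. \<lbrakk>j < l; l < m\<rbrakk> \<Longrightarrow> D j \<inter> D l = {}"
    and T: "\<And>j l. \<lbrakk>j < l; l < m\<rbrakk> \<Longrightarrow> T j \<inter> T l = {}"
    and card: "\<And>j. j < m \<Longrightarrow> finite (D j) \<and> finite (T j) \<and> card (D j) = card (T j)"
  shows "\<exists>h. inj_on h (\<Union>j<m. D j) \<and> (\<forall>j<m. h ` D j = T j)"
  using assms
proof (induction m)
  case (Suc m)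
  then obtain h where h: "inj_on h (\<Union>j<m. D j)" "\<And>j. j < m \<Longrightarrow> h ` D j = T j"
    by (metis less_SucI)
  obtain b where b: "bij_betw b (D m) (T m)"
    using Suc.prems(3)[of m] finite_same_card_bij by blast
  define h' where "h' = (\<lambda>x. if x \<in> D m then b x else h x)"
  have bm: "h' ` D m = T m" "inj_on h' (D m)"
    using b by (auto simp: bij_betw_def h'_def inj_on_def)
  have hj: "h' ` D j = T j" if "j < m" for j
  proof -
    have "h' ` D j = h ` D j"
      using Suc.prems(1)[of j m] that by (intro image_cong) (auto simp: h'_def)
    then show ?thesis using h(2) that by simp
  qed
  have "inj_on h' (\<Union>j<m. D j)"
    using h(1) by (rule inj_on_cong[THEN iffD1, rotated]) (use Suc.prems(1) in \<open>fastforce simp: h'_def\<close>)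
  moreover have "h' ` D m \<inter> h' ` (\<Union>j<m. D j) = {}"
    unfolding image_UN bm(1) using Suc.prems(2) hj by fastforce
  ultimately have "inj_on h' (D m \<union> (\<Union>j<m. D j))"
    using bm(2) by (auto simp: inj_on_Un)
  then show ?case
    using bm(1) hj by (intro exI[of _ h']) (auto simp: lessThan_Suc less_Suc_eq)
qed simp

lemma mono_intervals_disjoint:
  fixes lo :: "nat \<Rightarrow> nat"
  assumes "mono lo" "j < l"
  shows "{lo j..<lo (Suc j)} \<inter> {lo l..<lo (Suc l)} = {}"
  using monoD[OF assms(1), of "Suc j" l] assms(2) by auto

lemma Union_mono_intervals:
  fixes lo :: "nat \<Rightarrow> nat"
  assumes "mono lo"
  shows "(\<Union>j<m. {lo j..<lo (Suc j)}) = {lo 0..<lo m}"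
proof (induction m)
  case (Suc m)
  have "lo 0 \<le> lo m" "lo m \<le> lo (Suc m)" using assms by (simp_all add: monoD)
  then show ?case
    by (simp add: lessThan_Suc Suc Un_commute ivl_disj_un_two)
qed simp

text \<open>The tent consists of five blocks of vertices, numbered from 0: its edges are blocks 0,
  1, then 0, 2, 4, then 1, 3, 4. They go to the union of A and B, to f and to g, with v as the image
  of block 4; the disjointness hypotheses keep the images of the blocks apart.\<close>

lemma contains_tentI:
  fixes E :: "'a set set"
  assumes V: "finite V" and E: "\<And>e. e \<in> E \<Longrightarrow> e \<subseteq> V \<and> card e = r"
    and i: "1 \<le> i" "i < r"
    and e: "A \<inter> B = {}" "A \<union> B \<in> E" "card B = i"
    and f: "f \<in> E" "insert v B \<subseteq> f" "f \<inter> A = {}"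
    and g: "g \<in> E" "insert v A \<subseteq> g" "g \<inter> f = {v}"
    and v: "v \<notin> A \<union> B"
  shows "contains_subgraph (V, E) (tent r i)"
proof -
  have fin: "finite f" "finite g" "finite A" "finite B"
    using V E e f g by (meson finite_Un finite_subset)+
  have cards: "card f = r" "card g = r" "card A = r - i"
    using E[OF f(1)] E[OF g(1)] E[OF e(2)] card_Un_disjoint[OF fin(3,4) e(1)] e(3) by auto
  \<comment> \<open>Left ends of the blocks {1..i}, {i+1..r}, {r+1..2r-i-1}, {2r-i..2r-2} and
    {2r-1}; the fourth is empty for i = 1.\<close>
  define lo where "lo = (\<lambda>j::nat. if j = 0 then 1 else if j = 1 then i + 1 else if j = 2 then r + 1
    else if j = 3 then 2*r - i else if j = 4 then 2*r - 1 else 2*r)"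
  define D where "D = (\<lambda>j. {lo j..<lo (Suc j)})"
  define T where "T = (\<lambda>j::nat. if j = 0 then B else if j = 1 then A
    else if j = 2 then f - insert v B else if j = 3 then g - insert v A else {v})"
  have "mono lo"
    unfolding mono_iff_le_Suc lo_def using i by auto
  note D_part = Union_mono_intervals[OF this] mono_intervals_disjoint[OF this]
  have "\<exists>h. inj_on h (\<Union>j<5. D j) \<and> (\<forall>j<5. h ` D j = T j)"
  proof (rule ex_inj_matching_pieces)
    fix j l :: nat assume jl: "j < l" "l < 5"
    show "D j \<inter> D l = {}" using D_part(2)[OF jl(1)] by (simp add: D_def)
    have gf: "x = v" if "x \<in> g" "x \<in> f" for x using g(3) that by blast
    have gB: "g \<inter> B = {}" using gf f(2) v by blast
    have "l = 1 \<or> l = 2 \<or> l = 3 \<or> l = 4" "j = 0 \<or> j = 1 \<or> j = 2 \<or> j = 3"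
      using jl by auto
    then show "T j \<inter> T l = {}"
      using jl(1) gB gf f(3) e(1) v unfolding T_def by (elim disjE) auto
  next
    fix j :: nat assume "j < 5"
    then have "j = 0 \<or> j = 1 \<or> j = 2 \<or> j = 3 \<or> j = 4" by auto
    moreover have "card (f - insert v B) = r - i - 1"
      using f(2) v fin cards e(3) by (simp add: card_Diff_subset)
    moreover have "card (g - insert v A) = i - 1"
      using g(2) v fin cards i by (simp add: card_Diff_subset)
    ultimately show "finite (D j) \<and> finite (T j) \<and> card (D j) = card (T j)"
      using fin cards e(3) i by (elim disjE) (simp_all add: D_def T_def lo_def)
  qed
  then obtain h where h: "inj_on h (\<Union>j<5. D j)" "\<And>j. j < 5 \<Longrightarrow> h ` D j = T j" by blast
  have UD: "(\<Union>j<5. D j) = {1..2*r-1}"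
    using i unfolding D_def D_part(1) by (auto simp: lo_def)
  have Ds: "D 0 = {1..i}" "D 1 = {i+1..r}" "D 2 = {r+1..2*r-i-1}"
      "D 3 = {2*r-i..2*r-2}" "D 4 = {2*r-1}"
    using i by (auto simp: D_def lo_def)
  have im: "h ` {1..i} = B" "h ` {i+1..r} = A" "h ` {r+1..2*r-i-1} = f - insert v B"
      "h ` {2*r-i..2*r-2} = g - insert v A" "h ` {2*r-1} = {v}"
    using h(2)[of 0] h(2)[of 1] h(2)[of 2] h(2)[of 3] h(2)[of 4] unfolding Ds by (simp_all add: T_def)
  have "{1..r} = {1..i} \<union> {i+1..r}" using i by auto
  then have 1: "h ` {1..r} = A \<union> B"
    using im(1,2) by (simp only: image_Un Un_commute)
  have 2: "h ` ({1..i} \<union> {r+1..2*r-i-1} \<union> {2*r-1}) = f"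
    unfolding image_Un im using f by blast
  have "{2*r-i..2*r-1} = {2*r-i..2*r-2} \<union> {2*r-1}" using i by auto
  then have 3: "h ` ({i+1..r} \<union> {2*r-i..2*r-1}) = g"
    using g(2) by (simp only: image_Un im) blast
  have "h ` (\<Union>j<5. D j) = (\<Union>j<5. T j)"
    unfolding image_UN by (rule SUP_cong) (simp_all add: h(2))
  moreover have "T j \<subseteq> V" for j
    using E[OF e(2)] E[OF f(1)] E[OF g(1)] f(2) by (auto simp: T_def)
  ultimately have "h ` {1..2*r-1} \<subseteq> V" unfolding UD by blast
  then show ?thesis
    unfolding contains_subgraph_def tent_def
    using h(1) 1 2 3 e f g by (intro exI[of _ h]) (auto simp: UD)
qed

text \<open>In the cleaned hypergraph a homomorphic image of a tent can be replaced by a genuine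
  tent, so tent-freeness yields \<open>link_disjoint\<close>. The cleaning costs only a term of
  lower order in the number of vertices.\<close>

lemma card_tent_free_le:
  fixes E :: "'a set set"
  assumes V: "finite V" and E: "\<And>e. e \<in> E \<Longrightarrow> e \<subseteq> V \<and> card e = r"
    and k: "1 \<le> k" "k < r" "(\<Sum>j=k+1..r. 1 / real j) \<le> 1"
    and free: "family_free (tent_family r k) (V, E)"
  shows "real (card E) \<le> (real (card V) / real r) ^ r + real ((r + 1) * r) * real (card V) ^ (r - 1)"
proof -
  \<comment> \<open>The factor r + 1 exceeds the size of each set avoided below, namely A and f
    without v.\<close>
  from ex_codegree_cleaned[OF V, of E r "r + 1"] E
  obtain E' where E': "E' \<subseteq> E" "card E \<le> card E' + (r + 1) * r * card V ^ (r - 1)"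
    and deg': "\<forall>S. S \<noteq> {} \<and> card S < r \<and> (\<exists>e\<in>E'. S \<subseteq> e) \<longrightarrow>
      (r + 1) * card V ^ (r - 1 - card S) \<le> card {e \<in> E'. S \<subseteq> e}"
    by auto
  then have deg: "(r + 1) * card V ^ (r - 1 - card S) \<le> card {e \<in> E'. S \<subseteq> e}"
    if "S \<noteq> {}" "card S < r" "\<exists>e\<in>E'. S \<subseteq> e" for S
    using that by simp
  have E'E: "e \<subseteq> V \<and> card e = r" if "e \<in> E'" for e using E E' that by blast
  note avoid = ex_avoiding_edge[OF V E'E deg]
  have "real (card E') \<le> (real (card V) / real r) ^ r"
  proof (rule card_link_disjoint_le[OF V E'E k])
    fix i assume i: "1 \<le> i" "i \<le> k"
    show "link_disjoint i E'"
      unfolding link_disjoint_def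
    proof (intro allI impI notI, elim conjE bexE)
      fix A B v e2 e3
      assume *: "A \<inter> B = {}" "A \<union> B \<in> E'" "card B = i" "v \<notin> A \<union> B"
        "e3 \<in> E'" "insert v A \<subseteq> e3" "e2 \<in> E'" "insert v B \<subseteq> e2"
      have finAB: "finite (A \<union> B)" "card (A \<union> B) = r" using E'E[OF *(2)] V finite_subset by auto
      have "card A \<le> card (A \<union> B)" using finAB by (intro card_mono) auto
      then have "card A < r + 1" using finAB(2) by simp
      \<comment> \<open>The given edges only certify that B with v and A with v are covered. First f
        is chosen through B and v off A, then g through A and v off the rest of f.\<close>
      then obtain f where f: "f \<in> E'" "insert v B \<subseteq> f" "f \<inter> A = {}"
        using avoid[of "insert v B" e2 A] * finAB by auto
      have finf: "finite f" "card f = r" using E'E[OF f(1)] V finite_subset by auto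
      have "card (f - {v}) \<le> card f" using finf by (intro card_mono) auto
      then have "card (f - {v}) < r + 1" using finf by simp
      moreover have "(f - {v}) \<inter> insert v A = {}" using f by blast
      ultimately obtain g where g: "g \<in> E'" "insert v A \<subseteq> g" "g \<inter> (f - {v}) = {}"
        using avoid[of "insert v A" e3 "f - {v}"] * finf by auto
      have gf: "g \<inter> f = {v}" using f(2) g(2,3) by blast
      have "contains_subgraph (V, E) (tent r i)"
        by (rule contains_tentI[OF V E, where A = A and B = B and v = v and f = f and g = g])
          (use i k * f g gf E' in auto)
      moreover have "tent r i \<in> tent_family r k" using i by (auto simp: tent_family_def)
      ultimately show False using free unfolding family_free_def by blast
    qed
  qed
  moreover have "real (card E) \<le> real (card E' + (r + 1) * r * card V ^ (r - 1))"
    using E'(2) by (simp only: of_nat_le_iff)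
  ultimately show ?thesis by simp
qed

section \<open>The balanced complete r-partite construction and the resulting bounds\<close>

section \<open>Complete balanced partite hypergraphs and the density\<close>

text \<open>The r vertex classes are the residues modulo r, whose sizes differ by at most
  one.\<close>

definition partite_edges :: "nat \<Rightarrow> nat \<Rightarrow> nat set set" where
  "partite_edges r n = {e. e \<subseteq> {..<n} \<and> card e = r \<and> inj_on (\<lambda>v. v mod r) e}"

lemma card_partite_edges_ge:
  assumes r: "0 < r"
  shows "(n div r) ^ r \<le> card (partite_edges r n)"
proof -
  \<comment> \<open>In class c the edge takes the vertex with quotient g c; quotients below n div r
    keep it below n.\<close>
  let ?G = "\<lambda>g. (\<lambda>c. g c * r + c) ` {..<r}"
  have "card ({..<r} \<rightarrow>\<^sub>E {..<n div r}) \<le> card (partite_edges r n)"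
  proof (rule card_inj_on_le[where f = ?G])
    show "inj_on ?G ({..<r} \<rightarrow>\<^sub>E {..<n div r})"
    proof (rule inj_onI)
      fix g g' assume g: "g \<in> {..<r} \<rightarrow>\<^sub>E {..<n div r}" "g' \<in> {..<r} \<rightarrow>\<^sub>E {..<n div r}"
        and eq: "?G g = ?G g'"
      show "g = g'"
      proof (rule PiE_ext[OF g])
        fix c assume c: "c \<in> {..<r}"
        then have "g c * r + c \<in> ?G g'" using eq by blast
        then obtain c' where c': "c' < r" "g c * r + c = g' c' * r + c'" by auto
        have "c = (g c * r + c) mod r" using c by simp
        also have "\<dots> = c'" unfolding c'(2) using c' by simp
        finally have "c = c'" .
        then show "g c = g' c" using c' r by simp
      qed
    qed
    show "?G ` ({..<r} \<rightarrow>\<^sub>E {..<n div r}) \<subseteq> partite_edges r n"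
    proof clarify
      fix g assume g: "g \<in> {..<r} \<rightarrow>\<^sub>E {..<n div r}"
      have lt: "g c * r + c < n" if "c < r" for c
      proof -
        have "g c < n div r" using g that by (auto simp: PiE_def Pi_def)
        then have "Suc (g c) * r \<le> (n div r) * r" by (intro mult_right_mono) auto
        also have "\<dots> \<le> n" by simp
        finally show ?thesis using that by simp
      qed
      have "inj_on (\<lambda>v. v mod r) (?G g)" by (auto simp: inj_on_def)
      moreover have "inj_on (\<lambda>c. g c * r + c) {..<r}"
      proof (rule inj_onI)
        fix c c' assume *: "c \<in> {..<r}" "c' \<in> {..<r}" "g c * r + c = g c' * r + c'"
        have "c = (g c * r + c) mod r" using *(1) by simp
        also have "\<dots> = c'" unfolding *(3) using *(2) by simp
        finally show "c = c'" .
      qed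
      then have "card (?G g) = r" by (simp add: card_image)
      ultimately show "?G g \<in> partite_edges r n"
        using lt by (auto simp: partite_edges_def)
    qed
    show "finite (partite_edges r n)" by (simp add: partite_edges_def)
  qed
  then show ?thesis by (simp add: card_PiE)
qed

lemma partite_edges_tent_free:
  assumes "k < r"
  shows "family_free (tent_family r k) ({..<n}, partite_edges r n)"
  unfolding family_free_def
proof (intro ballI notI)
  fix F assume "F \<in> tent_family r k" and "contains_subgraph ({..<n}, partite_edges r n) F"
  then obtain i where i: "1 \<le> i" "i \<le> k" and "contains_subgraph ({..<n}, partite_edges r n) (tent r i)"
    by (auto simp: tent_family_def)
  then obtain h where inj: "inj_on h {1..2*r-1}"
    and h1: "h ` {1..r} \<in> partite_edges r n"
    and h2: "h ` ({1..i} \<union> {r+1..2*r-i-1} \<union> {2*r-1}) \<in> partite_edges r n"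
    and h3: "h ` ({i+1..r} \<union> {2*r-i..2*r-1}) \<in> partite_edges r n"
    unfolding contains_subgraph_def tent_def by auto
  let ?m = "\<lambda>v::nat. v mod r"
  have "card (?m ` h ` {1..r}) = r"
    using h1 by (simp add: partite_edges_def card_image)
  moreover have "?m ` h ` {1..r} \<subseteq> {..<r}" using assms by auto
  ultimately have "?m ` h ` {1..r} = {..<r}" by (intro card_subset_eq) auto
  then have "?m (h (2*r-1)) \<in> ?m ` h ` {1..r}" using assms by simp
  then obtain u where u: "u \<in> {1..r}" "?m (h u) = ?m (h (2*r-1))" by auto
  \<comment> \<open>The second edge contains 1..i and the third i+1..r, both together with 2r-1.
    Residues are distinct on either image, so the equal residues force equal vertices.\<close>
  have "h u = h (2*r-1)"
  proof (cases "u \<le> i")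
    case True
    then have "h u \<in> h ` ({1..i} \<union> {r+1..2*r-i-1} \<union> {2*r-1})"
      using u(1) by (intro imageI) simp
    moreover have "inj_on ?m (h ` ({1..i} \<union> {r+1..2*r-i-1} \<union> {2*r-1}))"
      using h2 unfolding partite_edges_def by blast
    ultimately show ?thesis using u(2) by (elim inj_onD) auto
  next
    case False
    then have "h u \<in> h ` ({i+1..r} \<union> {2*r-i..2*r-1})"
      using u(1) by (intro imageI) simp
    moreover have "h (2*r-1) \<in> h ` ({i+1..r} \<union> {2*r-i..2*r-1})"
      using i assms by (intro imageI) auto
    moreover have "inj_on ?m (h ` ({i+1..r} \<union> {2*r-i..2*r-1}))"
      using h3 unfolding partite_edges_def by blast
    ultimately show ?thesis using u(2) by (elim inj_onD)
  qed
  moreover have "u \<in> {1..2*r-1}" "2*r-1 \<in> {1..2*r-1}" using u(1) assms by auto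
  ultimately have "u = 2*r-1" using inj by (simp only: inj_on_eq_iff)
  then show False using u i assms by auto
qed

lemma turan_number_bounds:
  fixes n :: nat
  assumes k: "1 \<le> k" "k < r" "(\<Sum>j=k+1..r. 1 / real j) \<le> 1"
  defines "t \<equiv> turan_number r (tent_family r k) n"
  shows "(n div r) ^ r \<le> t"
    and "real t \<le> (real n / real r) ^ r + real ((r + 1) * r) * real n ^ (r - 1)"
proof -
  define X where "X = {card (edges H) | H :: nat hypergraph.
    uniform_hypergraph r H \<and> card (verts H) = n \<and> family_free (tent_family r k) H}"
  have t: "t = Max X" by (simp add: t_def turan_number_def X_def)
  \<comment> \<open>\<open>Max\<close> needs a finite nonempty set: the crude bound 2^n gives
    finiteness, the partite hypergraph a member.\<close>
  have "X \<subseteq> {..2 ^ n}"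
  proof
    fix x assume "x \<in> X"
    then obtain H :: "nat hypergraph" where H: "x = card (edges H)" "uniform_hypergraph r H" "card (verts H) = n"
      by (auto simp: X_def)
    then have "card (edges H) \<le> card (Pow (verts H))"
      by (intro card_mono) (auto simp: uniform_hypergraph_def)
    then show "x \<in> {..2 ^ n}" using H by (simp add: card_Pow uniform_hypergraph_def)
  qed
  then have finX: "finite X" using finite_subset by blast
  have P: "card (partite_edges r n) \<in> X"
    unfolding X_def using partite_edges_tent_free[OF k(2), of n]
    by (intro CollectI exI[of _ "({..<n}, partite_edges r n)"])
      (auto simp: uniform_hypergraph_def partite_edges_def)
  show "(n div r) ^ r \<le> t"
    using card_partite_edges_ge[of r n] Max_ge[OF finX P] k by (simp add: t)
  have "Max X \<in> X" using P finX by (intro Max_in) auto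
  then obtain H :: "nat hypergraph" where H: "t = card (edges H)" "uniform_hypergraph r H" "card (verts H) = n"
    "family_free (tent_family r k) (verts H, edges H)"
    by (auto simp: X_def t)
  show "real t \<le> (real n / real r) ^ r + real ((r + 1) * r) * real n ^ (r - 1)"
    unfolding H(1) H(3)[symmetric]
    by (rule card_tent_free_le[OF _ _ k H(4)]) (use H(2) in \<open>auto simp: uniform_hypergraph_def\<close>)
qed

section \<open>Passage to the limit by sandwiching\<close>

lemma turan_ratio_tent_tendsto:
  assumes k: "1 \<le> k" "k < r" "(\<Sum>j=k+1..r. 1 / real j) \<le> 1"
  shows "turan_ratio r (tent_family r k) \<longlonglongrightarrow> fact r / real r ^ r"
proof (rule tendsto_sandwich)
  define M where "M = real ((r + 1) * r)"
  have r: "0 < r" using k by simp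
  \<comment> \<open>Uses n div r >= n/r - 1 and r! * (n choose r) <= n^r.\<close>
  show "\<forall>\<^sub>F n in sequentially. fact r * (1 / real r - 1 / real n) ^ r \<le> turan_ratio r (tent_family r k) n"
    using eventually_gt_at_top[of r]
  proof eventually_elim
    case (elim n)
    define b where "b = real (n choose r)"
    have b: "0 < b" using elim by (simp add: b_def)
    have "real ((n choose r) * fact r) \<le> real (n ^ r)"
      unfolding of_nat_le_iff by (rule binomial_fact_pow)
    then have bn: "fact r * b \<le> real n ^ r" by (simp add: b_def mult.commute)
    have "real n / real r - 1 \<le> real (n div r)"
      using floor_correct[of "real n / real r"] by (simp add: floor_divide_of_nat_eq)
    then have "(real n / real r - 1) ^ r \<le> real (n div r) ^ r"
      using elim r by (intro power_mono) (auto simp: field_simps)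
    also have "\<dots> \<le> turan_number r (tent_family r k) n"
      using turan_number_bounds(1)[OF k, of n] by (metis of_nat_le_iff of_nat_power)
    finally have 1: "(real n / real r - 1) ^ r \<le> turan_number r (tent_family r k) n" .
    have nz: "1 / real r - 1 / real n = (real n / real r - 1) / real n"
      using elim by (simp add: field_simps)
    have p: "0 \<le> 1 / real r - 1 / real n"
      using elim r by (simp add: field_simps)
    have "fact r * (1 / real r - 1 / real n) ^ r * b = (fact r * b) * (1 / real r - 1 / real n) ^ r"
      by simp
    also have "\<dots> \<le> real n ^ r * (1 / real r - 1 / real n) ^ r"
      using bn p by (intro mult_right_mono) auto
    also have "\<dots> = (real n / real r - 1) ^ r"
      unfolding nz power_divide using elim by simp
    also note 1
    finally show ?case
      using b by (simp add: turan_ratio_def b_def pos_le_divide_eq)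
  qed
  \<comment> \<open>The last factor is (n / (n - r))^r, which bounds n^r / (r! * (n choose r))
    because r! * (n choose r) >= (n - r)^r.\<close>
  show "\<forall>\<^sub>F n in sequentially. turan_ratio r (tent_family r k) n
      \<le> fact r * ((1 / real r) ^ r + M * (1 / real n)) * (1 + real r / (real n - real r)) ^ r"
    using eventually_gt_at_top[of r]
  proof eventually_elim
    case (elim n)
    define b where "b = real (n choose r)"
    have b: "0 < b" using elim by (simp add: b_def)
    have "(real n - real r) ^ r = (\<Prod>i=0..<r. real n - real r)" by simp
    also have "\<dots> \<le> (\<Prod>i=0..<r. real n - real i)"
      using elim by (intro prod_mono) auto
    also have "\<dots> = fact r * b"
      by (simp add: b_def binomial_gbinomial gbinomial_prod_rev)
    finally have 1: "(real n - real r) ^ r \<le> fact r * b" .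
    have n: "0 < real n" "0 < real n - real r" using elim by auto
    have 2: "real n ^ r = (real n - real r) ^ r * (1 + real r / (real n - real r)) ^ r"
    proof -
      have "1 + real r / (real n - real r) = real n / (real n - real r)"
        using n by (simp add: field_simps)
      then show ?thesis using n by (simp add: power_divide)
    qed
    define c where "c = (1 / real r) ^ r + M * (1 / real n)"
    have c: "0 \<le> c" by (simp add: c_def M_def)
    have "real n ^ r = real n * real n ^ (r - 1)"
      using r by (metis Suc_pred' power_Suc)
    then have "(real n / real r) ^ r + M * real n ^ (r - 1) = real n ^ r * c"
      using n by (simp add: c_def power_divide field_simps)
    then have "turan_number r (tent_family r k) n \<le> real n ^ r * c"
      using turan_number_bounds(2)[OF k, of n] by (simp add: M_def)
    also have "\<dots> = (real n - real r) ^ r * ((1 + real r / (real n - real r)) ^ r * c)"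
      unfolding 2 by simp
    also have "\<dots> \<le> fact r * b * ((1 + real r / (real n - real r)) ^ r * c)"
      using c n by (intro mult_right_mono[OF 1] mult_nonneg_nonneg) auto
    finally show ?case
      using b by (simp add: turan_ratio_def b_def c_def pos_divide_le_eq mult_ac)
  qed
  have "(\<lambda>n. fact r * (1 / real r - 1 / real n) ^ r) \<longlonglongrightarrow> fact r * (1 / real r - 0) ^ r"
    by (intro tendsto_intros lim_1_over_n)
  then show "(\<lambda>n. fact r * (1 / real r - 1 / real n) ^ r) \<longlonglongrightarrow> fact r / real r ^ r"
    by (simp add: power_divide)
  have "(\<lambda>n. real r / (real n - real r)) \<longlonglongrightarrow> 0"
  proof (rule real_tendsto_divide_at_top[OF tendsto_const])
    show "filterlim (\<lambda>n. real n - real r) at_top sequentially"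
      using filterlim_tendsto_add_at_top[OF tendsto_const[of "- real r"] filterlim_real_sequentially] by simp
  qed
  then have "(\<lambda>n. fact r * ((1 / real r) ^ r + M * (1 / real n)) * (1 + real r / (real n - real r)) ^ r)
      \<longlonglongrightarrow> fact r * ((1 / real r) ^ r + M * 0) * (1 + 0) ^ r"
    by (intro tendsto_intros lim_1_over_n)
  then show "(\<lambda>n. fact r * ((1 / real r) ^ r + M * (1 / real n)) * (1 + real r / (real n - real r)) ^ r)
      \<longlonglongrightarrow> fact r / real r ^ r"
    by (simp add: power_divide)
qed

theorem theorem1p3:
  fixes r k :: nat
  assumes "r \<ge> 4"
    and "k = nat \<lceil>real r / exp 1\<rceil>"
  shows "convergent (turan_ratio r (tent_family r k))
         \<and> turan_density r (tent_family r k) = fact r / real r ^ r"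
proof -
  have e: "2 \<le> exp (1::real)" using exp_ge_add_one_self[of 1] by simp
  have ge: "real r / exp 1 \<le> real k"
    using assms(2) by (simp add: of_nat_ceiling)
  have "0 < real r / exp 1" using assms(1) by simp
  then have k1: "1 \<le> k" using ge by linarith
  have "real r / exp 1 \<le> real r / 2" using e by (intro divide_left_mono) auto
  moreover have "real k < real r / exp 1 + 1"
    using assms(2) \<open>0 < real r / exp 1\<close> by linarith
  \<comment> \<open>k < r/e + 1 <= r/2 + 1 < r.\<close>
  ultimately have kr: "k < r" using assms(1) by linarith
  \<comment> \<open>The choice of k enters here: k >= r/e means ln (r/k) <= 1, which bounds the
    harmonic sum.\<close>
  have "real r / real k \<le> exp 1" using ge k1 by (simp add: field_simps)
  then have "ln (real r / real k) \<le> ln (exp 1)" using k1 kr by (subst ln_le_cancel_iff) auto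
  then have "(\<Sum>j=k+1..r. 1 / real j) \<le> 1"
    using sum_inverse_le_ln[of k r] k1 kr by simp
  then have "turan_ratio r (tent_family r k) \<longlonglongrightarrow> fact r / real r ^ r"
    by (rule turan_ratio_tent_tendsto[OF k1 kr])
  then show ?thesis
    by (auto simp: convergent_def turan_density_def limI)
qed

end
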